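(* Fix integers $k,l\ge 0$ with $k+l>0$ and $n\ge1$, let $v\in a_{k,l}(n)$ and $A,B\in I(k,l)$. For each of the four variants $(\epsilon,\delta)\in\{\text{regular},\text{dual}\}^2$: if $v\mapsto (P^*_A,Q^*_A)$ under the $(\epsilon,\delta)$-$A$-RSK and $v\mapsto (P^*_B,Q^*_B)$ under the $(\epsilon,\delta)$-$B$-RSK, then $\mathrm{sh}(P^*_A)=\mathrm{sh}(P^*_B)$, and consequently $Q^*_A=Q^*_B$. (Part (a): (regular, regular); (b): (regular, dual); (c): (dual, regular); (d): (dual, dual).)
   Context: Let $t_1,\dots,t_k,u_1,\dots,u_l$ be distinct symbols ("$t$-letters" and "$u$-letters"). A shuffle is a total order $<_A$ on $\{t_1,\dots,t_k,u_1,\dots,u_l\}$ with $t_1<_A\cdots<_A t_k$ and $u_1<_A\cdots<_A u_l$; $I(k,l)$ is the set of shuffles. $a_{k,l}(n)$ is the set of words $v_1\cdots v_n$ in these letters. Tableaux are fillings of Young diagrams (English convention), $c(i,j)$ the cell in row $i$, column $j$. The $(\epsilon,\delta)$-$A$-RSK insertion of a letter $x$ proceeds in steps, each inserting a letter $y$ into a row or column: initially $x$ is inserted into row 1 if it is a $t$-letter, into column 1 if it is a $u$-letter. Inserting a $t$-letter $y$ into row $r$: if $\epsilon=$ regular (resp. dual), $y$ bumps the leftmost entry of row $r$ that is strictly $A$-greater than $y$ (resp. $A$-greater than or equal to $y$); if there is none, $y$ is placed in a new cell at the end of row $r$. Inserting a $u$-letter $y$ into column $c$: if $\delta=$ regular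 (resp. dual), $y$ bumps the topmost entry of column $c$ strictly $A$-greater than $y$ (resp. $A$-greater than or equal to $y$); if none, $y$ is placed in a new cell at the bottom of column $c$. An entry bumped from $c(i,j)$ is next inserted into row $i+1$ if it is a $t$-letter, into column $j+1$ if it is a $u$-letter; insertion ends when a new cell is created. The insertion tableau $P^*_A$ of $v$ is obtained by inserting $v_1,\dots,v_n$ successively into the empty tableau, and the recording tableau $Q^*_A$ is the standard Young tableau of the same shape with entry $m$ in the cell created while inserting $v_m$. *)

theory Defs
  imports Main
begin

datatype letter = T nat | U nat

definition letters :: "nat \<Rightarrow> nat \<Rightarrow> letter set" where
  "letters k l = T ` {1..k} \<union> U ` {1..l}"

text \<open>A shuffle is given by its strict order: \<open>(x, y) \<in> A\<close> means \<open>x <\<^sub>A y\<close>.\<close>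

definition shuffle_orders :: "nat \<Rightarrow> nat \<Rightarrow> letter rel set" where
  "shuffle_orders k l = {A. A \<subseteq> letters k l \<times> letters k l \<and>
     strict_linear_order_on (letters k l) A \<and>
     (\<forall>i j. 1 \<le> i \<and> i < j \<and> j \<le> k \<longrightarrow> (T i, T j) \<in> A) \<and>
     (\<forall>i j. 1 \<le> i \<and> i < j \<and> j \<le> l \<longrightarrow> (U i, U j) \<in> A)}"

definition words :: "nat \<Rightarrow> nat \<Rightarrow> nat \<Rightarrow> letter list set" where
  "words k l n = {v. length v = n \<and> set v \<subseteq> letters k l}"

text \<open>A filling is a partial map from cells to entries; \<open>(i, j)\<close> is the cell in row \<open>i\<close> and
  column \<open>j\<close>, both counted from 1, and the shape is the set of filled cells.\<close>

type_synonym cell = "nat \<times> nat"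
type_synonym 'a filling = "cell \<rightharpoonup> 'a"

definition sh :: "'a filling \<Rightarrow> cell set" where
  "sh P = dom P"

datatype variant = Regular | Dual

fun can_bump :: "variant \<Rightarrow> letter rel \<Rightarrow> letter \<Rightarrow> letter \<Rightarrow> bool" where
  "can_bump Regular A y z \<longleftrightarrow> (y, z) \<in> A"
| "can_bump Dual A y z \<longleftrightarrow> (y, z) \<in> A \<or> y = z"

text \<open>The cell taken by \<open>y\<close> when it is inserted into row \<open>s\<close> (\<open>t\<close>-letters) or
  column \<open>s\<close> (\<open>u\<close>-letters): the first cell whose entry it bumps if there is one, and otherwise
  the new cell after the last cell of that row or column.\<close>

fun landing_cell ::
  "letter rel \<Rightarrow> variant \<Rightarrow> variant \<Rightarrow> letter filling \<Rightarrow> letter \<Rightarrow> nat \<Rightarrow> cell" where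
  "landing_cell A \<epsilon> \<delta> P (T a) s =
     (let bumpable = (\<lambda>j. \<exists>z. P (s, j) = Some z \<and> can_bump \<epsilon> A (T a) z)
      in (s, if \<exists>j. bumpable j then LEAST j. bumpable j
             else Suc (card {j. (s, j) \<in> sh P})))"
| "landing_cell A \<epsilon> \<delta> P (U b) s =
     (let bumpable = (\<lambda>i. \<exists>z. P (i, s) = Some z \<and> can_bump \<delta> A (U b) z)
      in (if \<exists>i. bumpable i then LEAST i. bumpable i
          else Suc (card {i. (i, s) \<in> sh P}), s))"

fun next_line :: "cell \<Rightarrow> letter \<Rightarrow> nat" where
  "next_line (i, j) (T a) = i + 1"
| "next_line (i, j) (U b) = j + 1"

text \<open>The result is the new filling together with the cell that was created. For a shuffle order
  the recursion ends: along the bumping path the inserted letter never gets smaller, and a letter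
  that repeats moves on to the next row or column.\<close>

partial_function (tailrec) insert_from ::
  "letter rel \<Rightarrow> variant \<Rightarrow> variant \<Rightarrow> letter filling \<Rightarrow> letter \<Rightarrow> nat \<Rightarrow> letter filling \<times> cell" where
  "insert_from A \<epsilon> \<delta> P y s =
     (let c = landing_cell A \<epsilon> \<delta> P y s; P' = P(c \<mapsto> y)
      in case P c of
           None \<Rightarrow> (P', c)
         | Some z \<Rightarrow> insert_from A \<epsilon> \<delta> P' z (next_line c z))"

definition rsk ::
  "variant \<Rightarrow> variant \<Rightarrow> letter rel \<Rightarrow> letter list \<Rightarrow> letter filling \<times> nat filling" where
  "rsk \<epsilon> \<delta> A v =
     fold (\<lambda>(m, x) (P, Q). let (P', c) = insert_from A \<epsilon> \<delta> P x 1 in (P', Q(c \<mapsto> m)))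
       (enumerate 1 v) (Map.empty, Map.empty)"

end

theory Submission
  imports Defs
begin

text \<open>Standardise the word: break ties between equal letters by their times in the word (the later
  copy is larger in the regular variant and smaller in the dual one), so that the items inserted
  are the distinct times \<open>1, \<dots>, n\<close>, each of them a row item or a column item. Restricting the
  tableaux to the \<open>i\<close> smallest items gives for every \<open>i\<close> a growing sequence of shapes, indexed by
  time. The sequence for \<open>i + 1\<close> items is obtained from the one for \<open>i\<close> items by an operator that
  depends only on the time and on the kind of the new item (on recording tableaux it is row or
  column insertion of the time). A row operator commutes with a column operator, so the last
  sequence depends only on the order among the row items and the order among the column items, and
  these are the same for all shuffles.\<close>

section \<open>Cells and diagrams\<close>

text \<open>The restriction works because an item is never moved by a larger one. The largest item
  of a set therefore sits on a corner outside the shape of the others and moves exactly when that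
  shape grows into its cell, so shapes alone determine its cell, and its letter matters only through
  the kind. Two obstacles shape the proof. First, the two orders of adding a row item and a column
  item give the same path although the items need not stand in the same places: they may compete for
  one cell, and then their places depend on the order until both are pushed on.
  \<open>linked\<close> lists the possible states. Second, the algorithm compares letters, not
  items. Whenever a letter meets an equal one, the tie rule must agree with the standardised order;
  this depends on how the copies of a letter are spread over the lines (\<open>older_below\<close>,
  \<open>newer_above\<close>).\<close>

text \<open>Rows (\<open>\<kappa> = True\<close>) and columns (\<open>\<kappa> = False\<close>) are treated alike. The cell \<open>(0, 0)\<close> is virtual:
  it belongs to every diagram, stands for ``no cell'', and an item inserted into the first row or
  column counts as bumped from there.\<close>

definition line :: "bool \<Rightarrow> cell \<Rightarrow> nat" where
  "line \<kappa> c = (if \<kappa> then fst c else snd c)"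

definition mk_cell :: "bool \<Rightarrow> nat \<Rightarrow> nat \<Rightarrow> cell" where
  "mk_cell \<kappa> r j = (if \<kappa> then (r, j) else (j, r))"

lemma line_mk_cell [simp]: "line \<kappa> (mk_cell \<kappa> r j) = r" "line (\<not> \<kappa>) (mk_cell \<kappa> r j) = j"
    "line \<kappa> (mk_cell (\<not> \<kappa>) r j) = j"
  by (auto simp: line_def mk_cell_def)

lemma mk_cell_line [simp]: "mk_cell \<kappa> (line \<kappa> c) (line (\<not> \<kappa>) c) = c"
  by (auto simp: line_def mk_cell_def)

lemma mk_cell_Not: "mk_cell (\<not> \<kappa>) r j = mk_cell \<kappa> j r"
  by (auto simp: mk_cell_def)

lemma mk_cell_inject [simp]: "mk_cell \<kappa> r j = mk_cell \<kappa> r' j' \<longleftrightarrow> r = r' \<and> j = j'"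
  by (auto simp: mk_cell_def)

lemma mk_cell_eq_zero [simp]: "mk_cell \<kappa> r j = (0, 0) \<longleftrightarrow> r = 0 \<and> j = 0"
    "(0, 0) = mk_cell \<kappa> r j \<longleftrightarrow> r = 0 \<and> j = 0"
  by (auto simp: mk_cell_def)

lemma line_zero [simp]: "line \<kappa> (0, 0) = 0"
  by (simp add: line_def)

lemma obtain_mk_cell: obtains r j where "c = mk_cell \<kappa> r j"
  by (metis mk_cell_line)

section \<open>Diagrams as sets of cells\<close>

definition young :: "cell set \<Rightarrow> bool" where
  "young \<nu> \<longleftrightarrow> finite \<nu> \<and> (0, 0) \<in> \<nu> \<and>
     (\<forall>i j. (i, j) \<in> \<nu> \<longrightarrow> (i, j) \<noteq> (0, 0) \<longrightarrow> 0 < i \<and> 0 < j) \<and>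
     (\<forall>i j i' j'. (i, j) \<in> \<nu> \<longrightarrow> 0 < i' \<longrightarrow> i' \<le> i \<longrightarrow> 0 < j' \<longrightarrow> j' \<le> j \<longrightarrow> (i', j') \<in> \<nu>)"

lemma youngI:
  assumes "finite \<nu>" "(0, 0) \<in> \<nu>"
    "\<And>i j. mk_cell \<kappa> i j \<in> \<nu> \<Longrightarrow> mk_cell \<kappa> i j \<noteq> (0, 0) \<Longrightarrow> 0 < i \<and> 0 < j"
    "\<And>i j i' j'. mk_cell \<kappa> i j \<in> \<nu> \<Longrightarrow> 0 < i' \<Longrightarrow> i' \<le> i \<Longrightarrow> 0 < j' \<Longrightarrow> j' \<le> j \<Longrightarrow>
      mk_cell \<kappa> i' j' \<in> \<nu>"
  shows "young \<nu>"
proof -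
  have pos: "0 < i \<and> 0 < j" if "(i, j) \<in> \<nu>" "(i, j) \<noteq> (0, 0)" for i j
    by (metis assms(3) mk_cell_def that)
  have closed: "(i', j') \<in> \<nu>"
    if "(i, j) \<in> \<nu>" "0 < i'" "i' \<le> i" "0 < j'" "j' \<le> j" for i j i' j'
    using assms(4)[of i j i' j'] assms(4)[of j i j' i'] that
    by (cases \<kappa>) (simp_all only: mk_cell_def if_True if_False simp_thms)
  show ?thesis
    unfolding young_def
    by (intro conjI allI impI; (rule assms(1,2) | erule (1) pos[THEN conjunct1]
        | erule (1) pos[THEN conjunct2] | erule (4) closed))
qed

lemma young_finite: "young \<nu> \<Longrightarrow> finite \<nu>"
  by (simp add: young_def)

lemma young_zero: "young \<nu> \<Longrightarrow> (0, 0) \<in> \<nu>"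
  by (simp add: young_def)

lemma young_pos:
  assumes "young \<nu>" "mk_cell \<kappa> i j \<in> \<nu>" "0 < i \<or> 0 < j"
  shows "0 < i \<and> 0 < j"
proof -
  note * = assms(1)[unfolded young_def, THEN conjunct2, THEN conjunct2, THEN conjunct1, rule_format]
  show ?thesis using *[of i j] *[of j i] assms(2,3) by (cases \<kappa>) (auto simp: mk_cell_def)
qed

lemma young_closed:
  assumes "young \<nu>" "mk_cell \<kappa> i j \<in> \<nu>" "0 < i'" "i' \<le> i" "0 < j'" "j' \<le> j"
  shows "mk_cell \<kappa> i' j' \<in> \<nu>"
proof -
  note * = assms(1)[unfolded young_def, THEN conjunct2, THEN conjunct2, THEN conjunct2, rule_format]
  show ?thesis
    using *[of i j i' j'] *[of j i j' i'] assms(2-) by (cases \<kappa>) (simp_all add: mk_cell_def)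
qed

lemma young_Un:
  assumes "young \<nu>" "young \<mu>"
  shows "young (\<nu> \<union> \<mu>)"
proof (rule youngI[of _ True])
  fix i j i' j'
  assume *: "mk_cell True i j \<in> \<nu> \<union> \<mu>" "0 < i'" "i' \<le> i" "0 < j'" "j' \<le> j"
  from *(1) show "mk_cell True i' j' \<in> \<nu> \<union> \<mu>"
    using young_closed[OF assms(1) _ *(2-5)] young_closed[OF assms(2) _ *(2-5)] by (elim UnE) simp_all
next
  fix i j
  assume "mk_cell True i j \<in> \<nu> \<union> \<mu>" "mk_cell True i j \<noteq> (0, 0)"
  thus "0 < i \<and> 0 < j"
    using young_pos[OF assms(1), of True i j] young_pos[OF assms(2), of True i j] by auto
qed (use assms in \<open>simp_all add: young_finite young_zero\<close>)

definition end_of :: "bool \<Rightarrow> cell set \<Rightarrow> cell \<Rightarrow> cell" where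
  "end_of \<kappa> \<nu> c = mk_cell \<kappa> (Suc (line \<kappa> c)) (Suc (card {j. mk_cell \<kappa> (Suc (line \<kappa> c)) j \<in> \<nu>}))"

lemma end_of_eqI:
  assumes "\<And>j. mk_cell \<kappa> (Suc (line \<kappa> c)) j \<in> \<nu> \<longleftrightarrow> 0 < j \<and> j < e" "0 < e"
  shows "end_of \<kappa> \<nu> c = mk_cell \<kappa> (Suc (line \<kappa> c)) e"
proof -
  have "{j. mk_cell \<kappa> (Suc (line \<kappa> c)) j \<in> \<nu>} = {1..<e}"
    by (simp add: assms(1) set_eq_iff Suc_le_eq)
  thus ?thesis using assms(2) by (simp add: end_of_def)
qed

lemma end_ofE:
  assumes "young \<nu>"
  obtains e where "0 < e" "end_of \<kappa> \<nu> c = mk_cell \<kappa> (Suc (line \<kappa> c)) e"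
    "\<And>j. mk_cell \<kappa> (Suc (line \<kappa> c)) j \<in> \<nu> \<longleftrightarrow> 0 < j \<and> j < e"
proof -
  let ?m = "mk_cell \<kappa> (Suc (line \<kappa> c))"
  \<comment> \<open>Position 0 of a line is never filled; \<open>0 < e\<close> keeps it from being
    taken for the first gap.\<close>
  let ?e = "LEAST e. 0 < e \<and> ?m e \<notin> \<nu>"
  have "finite (?m -` \<nu>)"
    by (rule finite_vimageI) (auto simp: young_finite assms inj_on_def)
  hence "\<exists>e. e \<notin> ?m -` \<nu> \<union> {0}" by (intro ex_new_if_finite) auto
  hence ex: "\<exists>e. 0 < e \<and> ?m e \<notin> \<nu>" by auto
  have e: "0 < ?e \<and> ?m ?e \<notin> \<nu>" using LeastI_ex[OF ex] .
  have iff: "?m j \<in> \<nu> \<longleftrightarrow> 0 < j \<and> j < ?e" for j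
  proof
    assume m: "?m j \<in> \<nu>"
    hence "0 < j" using young_pos[OF assms] by blast
    moreover have "\<not> ?e \<le> j" using young_closed[OF assms m, of "Suc (line \<kappa> c)" ?e] e by auto
    ultimately show "0 < j \<and> j < ?e" by auto
  qed (use not_less_Least in blast)
  show ?thesis by (rule that[of ?e, OF _ end_of_eqI[OF iff] iff]) (use e in auto)
qed

lemma end_of_nonzero [simp]: "end_of \<kappa> \<nu> c \<noteq> (0, 0)"
  by (simp add: end_of_def)

lemma line_end_of [simp]: "line \<kappa> (end_of \<kappa> \<nu> c) = Suc (line \<kappa> c)"
  by (simp add: end_of_def)

lemma end_of_notin: "young \<nu> \<Longrightarrow> end_of \<kappa> \<nu> c \<notin> \<nu>"
  by (rule end_ofE[of \<nu> \<kappa> c]) auto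

text \<open>Let c be at position j of its line. As c has just been added, the next line does not
  reach position j, so its end has position at most j and is supported by the line of c.\<close>

lemma young_insert_end_of:
  assumes "young \<mu>" "young (insert c \<mu>)" "c = (0, 0) \<or> c \<notin> \<mu>"
  shows "young (insert (end_of \<kappa> (insert c \<mu>) c) (insert c \<mu>))"
proof -
  obtain r j where c: "c = mk_cell \<kappa> r j" by (rule obtain_mk_cell)
  define \<nu> where "\<nu> = insert c \<mu>"
  have y: "young \<nu>" and c_in: "c \<in> \<nu>" using assms(2) by (auto simp: \<nu>_def)
  obtain e where e: "0 < e" "end_of \<kappa> \<nu> c = mk_cell \<kappa> (Suc r) e"
      "\<And>j. mk_cell \<kappa> (Suc r) j \<in> \<nu> \<longleftrightarrow> 0 < j \<and> j < e"
    using end_ofE[OF y, of \<kappa> c thesis] unfolding c line_mk_cell by blast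
  have prev: "mk_cell \<kappa> r e \<in> \<nu>" if "0 < r"
  proof -
    have c0: "c \<noteq> (0, 0)" and "0 < j" using that young_pos[OF y, of \<kappa> r j] c c_in by auto
    have "mk_cell \<kappa> (Suc r) j \<notin> \<nu>"
      using young_closed[OF assms(1), of \<kappa> "Suc r" j r j] assms(3) c c0 that \<open>0 < j\<close> by (auto simp: \<nu>_def)
    hence "e \<le> j" using e(3)[of j] \<open>0 < j\<close> by linarith
    thus ?thesis using young_closed[OF y, of \<kappa> r j r e] c c_in that e(1) by auto
  qed
  show ?thesis
    unfolding \<nu>_def[symmetric]
  proof (rule youngI[of _ \<kappa>])
    fix i k i' k'
    assume a: "mk_cell \<kappa> i k \<in> insert (end_of \<kappa> \<nu> c) \<nu>" "0 < i'" "i' \<le> i" "0 < k'" "k' \<le> k"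
    show "mk_cell \<kappa> i' k' \<in> insert (end_of \<kappa> \<nu> c) \<nu>"
    proof (cases "mk_cell \<kappa> i k \<in> \<nu>")
      case True
      thus ?thesis using a young_closed[OF y, of \<kappa> i k i' k'] by auto
    next
      case False
      hence ik: "i = Suc r" "k = e" using a e(2) by auto
      show ?thesis
      proof (cases "i' = Suc r")
        case True
        thus ?thesis using e(2) e(3)[of k'] a(4,5) ik by (cases "k' = e") simp_all
      next
        case False
        hence "0 < r" "i' \<le> r" using a ik by auto
        thus ?thesis using young_closed[OF y prev, of i' k'] a ik by auto
      qed
    qed
  next
    fix i k assume a: "mk_cell \<kappa> i k \<in> insert (end_of \<kappa> \<nu> c) \<nu>" "mk_cell \<kappa> i k \<noteq> (0, 0)"
    show "0 < i \<and> 0 < k"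
    proof (cases "mk_cell \<kappa> i k \<in> \<nu>")
      case True
      thus ?thesis using young_pos[OF y True] a by auto
    next
      case False
      thus ?thesis using a e(1,2) by auto
    qed
  next
    show "finite (insert (end_of \<kappa> \<nu> c) \<nu>)" "(0, 0) \<in> insert (end_of \<kappa> \<nu> c) \<nu>"
      using y by (simp_all add: young_finite young_zero)
  qed
qed

text \<open>Of two free cells of a line, the farther one cannot be added before the nearer one. This
  turns equality of lines into equality of cells when copies of a letter are compared.\<close>

lemma addable_unique:
  assumes "young (insert (mk_cell \<kappa> r i) \<mu>)" "young (insert (mk_cell \<kappa> r j) \<mu>)"
    "mk_cell \<kappa> r i \<notin> \<mu>" "mk_cell \<kappa> r j \<notin> \<mu>" "0 < r"
  shows "i = j"
proof (rule ccontr)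
  have *: False if "i < j" "young (insert (mk_cell \<kappa> r j) \<mu>)" "mk_cell \<kappa> r i \<notin> \<mu>"
     "young (insert (mk_cell \<kappa> r i) \<mu>)" for i j
    using young_closed[OF that(2), of \<kappa> r j r i] young_pos[OF that(4), of \<kappa> r i] that \<open>0 < r\<close> by auto
  assume "i \<noteq> j"
  thus False using *[of i j] *[of j i] assms by linarith
qed

section \<open>Adding the largest item to a growth path\<close>

text \<open>\<open>f m\<close> is the cell added at time \<open>m\<close>, or \<open>(0, 0)\<close> if the shape does not change then.\<close>

type_synonym path = "nat \<Rightarrow> cell"

definition shape :: "path \<Rightarrow> nat \<Rightarrow> cell set" where
  "shape f m = f ` {..m}"

lemma shape_Suc: "shape f (Suc m) = insert (f (Suc m)) (shape f m)"
  by (simp add: shape_def atMost_Suc)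

definition growth :: "path \<Rightarrow> bool" where
  "growth f \<longleftrightarrow> f 0 = (0, 0) \<and> (\<forall>m. young (shape f m)) \<and>
     (\<forall>m. f (Suc m) = (0, 0) \<or> f (Suc m) \<notin> shape f m)"

text \<open>The cell at time \<open>m\<close> of an item that is inserted at time \<open>s\<close> and larger than all items that
  make up \<open>f\<close>; it is \<open>(0, 0)\<close> before time \<open>s\<close>.\<close>

fun pos :: "bool \<Rightarrow> nat \<Rightarrow> path \<Rightarrow> nat \<Rightarrow> cell" where
  "pos \<kappa> s f 0 = (0, 0)"
| "pos \<kappa> s f (Suc m) =
     (if Suc m = s \<or> pos \<kappa> s f m \<noteq> (0, 0) \<and> pos \<kappa> s f m = f (Suc m)
      then end_of \<kappa> (shape f (Suc m)) (f (Suc m)) else pos \<kappa> s f m)"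

text \<open>The largest item moves at time m + 1: it is inserted, or the smaller items claim its
  cell. Without the condition on (0, 0), an absent item would seem to be pushed whenever f stands
  still.\<close>

definition hit :: "bool \<Rightarrow> nat \<Rightarrow> path \<Rightarrow> nat \<Rightarrow> bool" where
  "hit \<kappa> s f m \<longleftrightarrow> Suc m = s \<or> pos \<kappa> s f m \<noteq> (0, 0) \<and> pos \<kappa> s f m = f (Suc m)"

declare pos.simps(2) [simp del]

lemma pos_Suc: "pos \<kappa> s f (Suc m) =
    (if hit \<kappa> s f m then end_of \<kappa> (shape f (Suc m)) (f (Suc m)) else pos \<kappa> s f m)"
  by (simp add: pos.simps hit_def)

text \<open>At a hit the old cell of the item was already filled and only changes its owner, so the
  joint shape gains the new cell of the item instead of the cell of f.\<close>

fun add_item :: "bool \<Rightarrow> nat \<Rightarrow> path \<Rightarrow> path" where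
  "add_item \<kappa> s f 0 = f 0"
| "add_item \<kappa> s f (Suc m) = (if hit \<kappa> s f m then pos \<kappa> s f (Suc m) else f (Suc m))"

lemma pos_eq_zero: "0 < s \<Longrightarrow> pos \<kappa> s f m = (0, 0) \<longleftrightarrow> m < s"
  by (induction m) (auto simp: pos_Suc hit_def)

text \<open>This includes the insertion itself: at time s the item is still on the virtual cell and
  f adds nothing, so both sides are (0, 0).\<close>

lemma hit_pos: "0 < s \<Longrightarrow> f s = (0, 0) \<Longrightarrow> hit \<kappa> s f m \<Longrightarrow> f (Suc m) = pos \<kappa> s f m"
  using pos_eq_zero[of s \<kappa> f m] by (auto simp: hit_def)

lemma growthD:
  assumes "growth f"
  shows "f 0 = (0, 0)" "young (shape f m)" "young (insert (f (Suc m)) (shape f m))"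
    "f (Suc m) = (0, 0) \<or> f (Suc m) \<notin> shape f m"
  using assms by (auto simp: growth_def shape_Suc[symmetric])

context
  fixes f :: path and s :: nat and \<kappa> :: bool
  assumes growth: "growth f" and s: "0 < s" "f s = (0, 0)"
begin

text \<open>The item stays on a corner outside the smaller items. At a hit this is
  \<open>young_insert_end_of\<close>; otherwise its cell and the new cell of f do not meet, and a
  union of diagrams is a diagram. The guard s \<le> m is there because (0, 0) lies in every
  shape.\<close>

lemma add_item_invariant:
  "young (insert (pos \<kappa> s f m) (shape f m)) \<and> (s \<le> m \<longrightarrow> pos \<kappa> s f m \<notin> shape f m) \<and>
   shape (add_item \<kappa> s f) m = insert (pos \<kappa> s f m) (shape f m)"
proof (induction m)
  case 0
  thus ?case
    using growthD(1)[OF growth] growthD(2)[OF growth, of 0] s(1)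
    by (auto simp: shape_def insert_absorb)
next
  case (Suc m)
  show ?case
  proof (cases "hit \<kappa> s f m")
    case True
    let ?c = "f (Suc m)"
    have p: "pos \<kappa> s f m = ?c" using hit_pos[OF s True] by simp
    have q: "pos \<kappa> s f (Suc m) = end_of \<kappa> (shape f (Suc m)) ?c" using True by (simp add: pos_Suc)
    have "shape (add_item \<kappa> s f) (Suc m) = insert (pos \<kappa> s f (Suc m)) (shape f (Suc m))"
      using Suc True by (simp add: shape_Suc p)
    moreover have "young (insert (pos \<kappa> s f (Suc m)) (shape f (Suc m)))"
      unfolding q shape_Suc by (rule young_insert_end_of[OF growthD(2-4)[OF growth]])
    moreover have "pos \<kappa> s f (Suc m) \<notin> shape f (Suc m)"
      unfolding q by (rule end_of_notin[OF growthD(2)[OF growth]])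
    ultimately show ?thesis by simp
  next
    case False
    have p: "pos \<kappa> s f (Suc m) = pos \<kappa> s f m" using False by (simp add: pos_Suc)
    have "young (insert (pos \<kappa> s f m) (shape f m) \<union> shape f (Suc m))"
      using Suc growthD(2)[OF growth, of "Suc m"] by (intro young_Un) simp_all
    hence "young (insert (pos \<kappa> s f m) (shape f (Suc m)))"
      by (simp add: shape_Suc insert_commute)
    moreover have "s \<le> Suc m \<Longrightarrow> pos \<kappa> s f m \<notin> shape f (Suc m)"
      using False Suc pos_eq_zero[OF s(1), of \<kappa> f m] by (auto simp: hit_def shape_Suc)
    moreover have "shape (add_item \<kappa> s f) (Suc m) = insert (pos \<kappa> s f m) (shape f (Suc m))"
      using Suc False by (simp add: shape_Suc insert_commute)
    ultimately show ?thesis by (simp add: p)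
  qed
qed

lemma young_pos_item: "young (insert (pos \<kappa> s f m) (shape f m))"
  and pos_notin: "s \<le> m \<Longrightarrow> pos \<kappa> s f m \<notin> shape f m"
  and shape_add_item: "shape (add_item \<kappa> s f) m = insert (pos \<kappa> s f m) (shape f m)"
  using add_item_invariant by simp_all

lemma growth_add_item: "growth (add_item \<kappa> s f)"
  unfolding growth_def
proof (intro conjI allI)
  show "add_item \<kappa> s f 0 = (0, 0)" using growthD(1)[OF growth] by simp
  fix m
  show "young (shape (add_item \<kappa> s f) m)" using add_item_invariant by simp
  show "add_item \<kappa> s f (Suc m) = (0, 0) \<or> add_item \<kappa> s f (Suc m) \<notin> shape (add_item \<kappa> s f) m"
  proof (cases "hit \<kappa> s f m")
    case True
    thus ?thesis
      using hit_pos[OF s True] end_of_notin[OF growthD(2)[OF growth, of "Suc m"], of \<kappa> "f (Suc m)"]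
      by (auto simp: shape_add_item pos_Suc shape_Suc)
  next
    case False
    thus ?thesis using growthD(4)[OF growth, of m] by (auto simp: shape_add_item hit_def)
  qed
qed

lemma add_item_eq_zero: "add_item \<kappa> s f m = (0, 0) \<longleftrightarrow> m \<noteq> s \<and> f m = (0, 0)"
  using s growthD(1)[OF growth] by (cases m) (auto simp: pos_Suc hit_def)

end

section \<open>Row and column items commute\<close>

text \<open>A cell q that is addable to \<mu> and lies on the line after c must be the end of that
  line. Any other q lies on a different line and does not shift this end.\<close>

lemma end_of_disjoint:
  assumes "young \<mu>" "young (insert c \<mu>)" "young (insert q \<mu>)" "q \<notin> \<mu>" "q \<noteq> end_of \<kappa> (insert c \<mu>) c"
  shows "end_of \<kappa> (insert q (insert c \<mu>)) c = end_of \<kappa> (insert c \<mu>) c"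
proof -
  obtain r j where c: "c = mk_cell \<kappa> r j" by (rule obtain_mk_cell)
  obtain r' j' where q: "q = mk_cell \<kappa> r' j'" by (rule obtain_mk_cell)
  define \<nu> where "\<nu> = insert c \<mu>"
  obtain e where e: "0 < e" "end_of \<kappa> \<nu> c = mk_cell \<kappa> (Suc (line \<kappa> c)) e"
      "\<And>j. mk_cell \<kappa> (Suc (line \<kappa> c)) j \<in> \<nu> \<longleftrightarrow> 0 < j \<and> j < e"
    using end_ofE[OF assms(2), of \<kappa> c thesis] unfolding \<nu>_def by blast
  have row: "mk_cell \<kappa> (Suc r) i \<in> \<nu> \<longleftrightarrow> mk_cell \<kappa> (Suc r) i \<in> \<mu>" for i
    by (simp add: \<nu>_def c)
  have "r' \<noteq> Suc r"
  proof
    assume r': "r' = Suc r"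
    have "0 < j'" using young_pos[OF assms(3), of \<kappa> r' j'] r' by (simp add: q)
    hence "e \<le> j'" using assms(4) row[of j'] e(3)[of j'] by (simp add: q r' c)
    moreover have "\<not> e < j'"
    proof
      assume "e < j'"
      hence "mk_cell \<kappa> (Suc r) e \<in> \<mu>"
        using young_closed[OF assms(3), of \<kappa> r' j' "Suc r" e] e(1) by (simp add: q r')
      thus False using row[of e] e(3)[of e] by (simp add: c)
    qed
    ultimately show False using assms(5)[folded \<nu>_def] e(2) by (simp add: q r' c)
  qed
  hence "mk_cell \<kappa> (Suc (line \<kappa> c)) j \<in> insert q \<nu> \<longleftrightarrow> 0 < j \<and> j < e" for j
    using e(3)[of j] by (simp add: q c)
  from end_of_eqI[OF this e(1)] show ?thesis using e(2) by (simp add: \<nu>_def)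
qed

text \<open>Both items want q, and the one that yields ends next to q, whichever it is. For the
  second claim: q is addable to \<mu>, so the line of c has a cell of \<mu> beside q; hence c lies
  farther out, and the crossing line after q is filled exactly up to the line of c.\<close>

lemma end_of_collision:
  assumes "young \<mu>" "young (insert c \<mu>)" "c = (0, 0) \<or> c \<notin> \<mu>"
    and "young (insert q \<mu>)" and q: "q = end_of \<kappa> (insert c \<mu>) c"
  shows "end_of \<kappa> (insert q (insert c \<mu>)) c = mk_cell \<kappa> (line \<kappa> q) (Suc (line (\<not> \<kappa>) q))"
    and "end_of (\<not> \<kappa>) (insert q (insert c \<mu>)) q = mk_cell \<kappa> (line \<kappa> q) (Suc (line (\<not> \<kappa>) q))"
proof -
  obtain r j where c: "c = mk_cell \<kappa> r j" by (rule obtain_mk_cell)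
  define \<nu> where "\<nu> = insert c \<mu>"
  have y: "young \<nu>" using assms(2) by (simp add: \<nu>_def)
  obtain e where e: "0 < e" "end_of \<kappa> \<nu> c = mk_cell \<kappa> (Suc (line \<kappa> c)) e"
      "\<And>j. mk_cell \<kappa> (Suc (line \<kappa> c)) j \<in> \<nu> \<longleftrightarrow> 0 < j \<and> j < e"
    using end_ofE[OF assms(2), of \<kappa> c thesis] unfolding \<nu>_def by blast
  have q: "q = mk_cell \<kappa> (Suc r) e" using q e(2) by (simp add: \<nu>_def c)
  have "mk_cell \<kappa> (Suc (line \<kappa> c)) j \<in> insert q \<nu> \<longleftrightarrow> 0 < j \<and> j < Suc e" for j
    using e(1) e(3)[of j] by (auto simp: q c)
  from end_of_eqI[OF this]
  show "end_of \<kappa> (insert q (insert c \<mu>)) c = mk_cell \<kappa> (line \<kappa> q) (Suc (line (\<not> \<kappa>) q))"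
    unfolding \<nu>_def[symmetric] by (simp add: q c)
  have above: "mk_cell \<kappa> r (Suc e) \<in> \<nu>" if "0 < r"
  proof -
    have "mk_cell \<kappa> r e \<in> \<mu>"
      using young_closed[OF assms(4), of \<kappa> "Suc r" e r e] that e(1) by (simp add: q)
    moreover have "c \<notin> \<mu>" using assms(3) that by (simp add: c)
    moreover have "0 < j" using young_pos[OF y, of \<kappa> r j] that by (simp add: \<nu>_def c)
    ultimately have "\<not> j \<le> e"
      using young_closed[OF assms(1), of \<kappa> r e r j] that by (auto simp: c)
    thus ?thesis using young_closed[OF y, of \<kappa> r j r "Suc e"] that by (simp add: \<nu>_def c)
  qed
  have "mk_cell (\<not> \<kappa>) (Suc (line (\<not> \<kappa>) q)) i \<in> insert q \<nu> \<longleftrightarrow> 0 < i \<and> i < Suc r" for i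
  proof
    assume "mk_cell (\<not> \<kappa>) (Suc (line (\<not> \<kappa>) q)) i \<in> insert q \<nu>"
    hence m: "mk_cell \<kappa> i (Suc e) \<in> \<nu>" by (simp add: q mk_cell_Not)
    have "0 < i" using young_pos[OF y m] by simp
    moreover have "\<not> Suc r \<le> i"
      using young_closed[OF y m, of "Suc r" "Suc e"] e(3)[of "Suc e"] by (auto simp: c)
    ultimately show "0 < i \<and> i < Suc r" by simp
  next
    assume "0 < i \<and> i < Suc r"
    thus "mk_cell (\<not> \<kappa>) (Suc (line (\<not> \<kappa>) q)) i \<in> insert q \<nu>"
      using young_closed[OF y above, of i "Suc e"] by (simp add: q mk_cell_Not)
  qed
  from end_of_eqI[OF this]
  show "end_of (\<not> \<kappa>) (insert q (insert c \<mu>)) q = mk_cell \<kappa> (line \<kappa> q) (Suc (line (\<not> \<kappa>) q))"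
    unfolding \<nu>_def[symmetric] by (simp add: q mk_cell_Not)
qed

text \<open>How a domino with inner cell c and outer cell q is resolved when c is claimed. The
  crossing item moves from c to q, since q is addable; the \<kappa>-item moves to the same cell from
  c or from q, since both lie on one \<kappa>-line.\<close>

lemma end_of_domino:
  assumes "young \<nu>" "c \<in> \<nu>" "c \<noteq> (0, 0)" "young (insert q \<nu>)" "q \<notin> \<nu>"
    and q: "q = mk_cell \<kappa> (line \<kappa> c) (Suc (line (\<not> \<kappa>) c))"
  shows "end_of (\<not> \<kappa>) \<nu> c = q" and "end_of \<kappa> (insert q \<nu>) q = end_of \<kappa> \<nu> c"
proof -
  obtain r j where c: "c = mk_cell \<kappa> r j" by (rule obtain_mk_cell)
  have rj: "0 < r \<and> 0 < j" using young_pos[OF assms(1), of \<kappa> r j] assms(2,3) by (auto simp: c)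
  have q: "q = mk_cell \<kappa> r (Suc j)" by (simp add: q c)
  have "mk_cell (\<not> \<kappa>) (Suc (line (\<not> \<kappa>) c)) i \<in> \<nu> \<longleftrightarrow> 0 < i \<and> i < r" for i
  proof
    assume "mk_cell (\<not> \<kappa>) (Suc (line (\<not> \<kappa>) c)) i \<in> \<nu>"
    hence m: "mk_cell \<kappa> i (Suc j) \<in> \<nu>" by (simp add: c mk_cell_Not)
    have "0 < i" using young_pos[OF assms(1) m] by simp
    moreover have "\<not> r \<le> i"
      using young_closed[OF assms(1) m, of r "Suc j"] assms(5) rj by (auto simp: q)
    ultimately show "0 < i \<and> i < r" by simp
  next
    assume "0 < i \<and> i < r"
    thus "mk_cell (\<not> \<kappa>) (Suc (line (\<not> \<kappa>) c)) i \<in> \<nu>"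
      using young_closed[OF assms(4), of \<kappa> r "Suc j" i "Suc j"] by (simp add: q c mk_cell_Not)
  qed
  from end_of_eqI[OF this] show "end_of (\<not> \<kappa>) \<nu> c = q" using rj by (simp add: q c mk_cell_Not)
  show "end_of \<kappa> (insert q \<nu>) q = end_of \<kappa> \<nu> c"
    by (simp add: end_of_def q c)
qed

text \<open>The positions \<open>p, q\<close> of the two largest items when the \<open>\<kappa>\<close>-item is added first, against their
  positions \<open>q', p'\<close> when it is added second: either each item has the same cell in both orders,
  or the two cells form a domino and whichever item was added first occupies its inner cell.\<close>

definition linked :: "cell \<Rightarrow> cell \<Rightarrow> cell \<Rightarrow> cell \<Rightarrow> bool" where
  "linked p q p' q' \<longleftrightarrow> p = q' \<and> p' = q \<and> (p = p' \<longrightarrow> p = (0, 0)) \<or>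
     p = p' \<and> q = q' \<and> p \<noteq> (0, 0) \<and> (\<exists>\<kappa>. q = mk_cell \<kappa> (line \<kappa> p) (Suc (line (\<not> \<kappa>) p)))"

lemma linked_sym: "linked p q p' q' \<Longrightarrow> linked p' q' p q"
  unfolding linked_def by metis

lemma add_item_zero:
  assumes "growth f" "0 < s" "f s = (0, 0)" "f s' = (0, 0)" "s' \<noteq> s"
  shows "add_item \<kappa> s f s' = (0, 0)"
  using add_item_eq_zero[OF assms(1-3)] assms(4,5) by simp

text \<open>Agreement of the paths at time m + 1 is read off from how the positions are linked at
  time m, so the induction has to carry the linkage along.\<close>

definition commutes_at :: "bool \<Rightarrow> nat \<Rightarrow> nat \<Rightarrow> path \<Rightarrow> nat \<Rightarrow> bool" where
  "commutes_at \<kappa> s s' f m \<longleftrightarrow>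
     add_item (\<not> \<kappa>) s' (add_item \<kappa> s f) m = add_item \<kappa> s (add_item (\<not> \<kappa>) s' f) m \<and>
     linked (pos \<kappa> s f m) (pos (\<not> \<kappa>) s' (add_item \<kappa> s f) m)
       (pos (\<not> \<kappa>) s' f m) (pos \<kappa> s (add_item (\<not> \<kappa>) s' f) m)"

lemma commutes_at_sym: "commutes_at \<kappa> s s' f m \<Longrightarrow> commutes_at (\<not> \<kappa>) s' s f m"
  unfolding commutes_at_def by (auto intro: linked_sym)

text \<open>If only the \<kappa>-item is pushed, its target is either apart from the other item
  (\<open>end_of_disjoint\<close>) or equal to its cell (\<open>end_of_collision\<close>). If both
  are pushed, they leave the inner cell of a domino; \<open>dir\<close> asks it to lie along a
  \<kappa>-line, and the other direction is the same case with the roles exchanged.\<close>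

lemma commutes_at_hit:
  assumes f: "growth f" "0 < s" "0 < s'" "s \<noteq> s'" "f s = (0, 0)" "f s' = (0, 0)"
    and IH: "commutes_at \<kappa> s s' f m" and hit: "hit \<kappa> s f m"
    and dir: "hit (\<not> \<kappa>) s' f m \<Longrightarrow> pos (\<not> \<kappa>) s' (add_item \<kappa> s f) m =
      mk_cell \<kappa> (line \<kappa> (pos \<kappa> s f m)) (Suc (line (\<not> \<kappa>) (pos \<kappa> s f m)))"
  shows "commutes_at \<kappa> s s' f (Suc m)"
proof -
  define g where "g = add_item \<kappa> s f"
  define g' where "g' = add_item (\<not> \<kappa>) s' f"
  define p where "p = pos \<kappa> s f m"
  define q where "q = pos (\<not> \<kappa>) s' g m"
  define p' where "p' = pos (\<not> \<kappa>) s' f m"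
  define q' where "q' = pos \<kappa> s g' m"
  define \<mu> where "\<mu> = shape f m"
  define c where "c = f (Suc m)"
  define \<nu> where "\<nu> = insert c \<mu>"
  define e where "e = end_of \<kappa> \<nu> c"
  have linked: "linked p q p' q'" using IH by (simp add: commutes_at_def p_def q_def p'_def q'_def g_def g'_def)
  have gg: "growth g" "growth g'" "g s' = (0, 0)" "g' s = (0, 0)"
    using growth_add_item[OF f(1,2,5)] growth_add_item[OF f(1,3,6)]
      add_item_zero[OF f(1,2,5,6)] add_item_zero[OF f(1,3,6,5)] f(4) by (auto simp: g_def g'_def)
  have y: "young \<mu>" "young \<nu>" "c = (0, 0) \<or> c \<notin> \<mu>"
    using growthD(2-4)[OF f(1), of m] by (auto simp: \<mu>_def \<nu>_def c_def)
  have c: "c = p" using hit_pos[OF f(2,5) hit] by (simp add: c_def p_def)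
  have ns': "Suc m \<noteq> s'"
    using f(4,6) hit by (auto simp: hit_def)
  have shape_f: "shape f (Suc m) = \<nu>" by (simp add: shape_Suc \<nu>_def \<mu>_def c_def)
  have p_Suc: "pos \<kappa> s f (Suc m) = e" using hit by (simp add: pos_Suc e_def shape_f c_def)
  have g_Suc: "g (Suc m) = e" using hit p_Suc by (simp add: g_def)
  have shape_g: "shape g m = \<nu>" "shape g (Suc m) = insert e \<nu>"
    using shape_add_item[OF f(1,2,5), of \<kappa>] p_Suc c by (simp_all add: g_def p_def \<nu>_def \<mu>_def shape_f)
  have hit_s: "Suc m = s \<or> p \<noteq> (0, 0)" using hit by (auto simp: hit_def p_def)
  show ?thesis
  proof (cases "hit (\<not> \<kappa>) s' f m")
    case False
    \<comment> \<open>In the domino state both items, each added first, would stand on c, and the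
      second one would be hit too.\<close>
    have "p = q'" "p' = q" "p = p' \<Longrightarrow> p = (0, 0)"
      using linked False c hit_s ns' unfolding linked_def by (auto simp: hit_def p'_def c_def)
    note pq = this
    have p'_Suc: "pos (\<not> \<kappa>) s' f (Suc m) = q" using False pq by (simp add: pos_Suc p'_def)
    have g'_Suc: "g' (Suc m) = c" using False by (simp add: g'_def c_def)
    have hit': "hit \<kappa> s g' m" using hit_s pq c g'_Suc by (auto simp: hit_def q'_def)
    have "shape g' m = insert q \<mu>"
      using shape_add_item[OF f(1,3,6), of "\<not> \<kappa>" m] pq by (simp add: g'_def p'_def \<mu>_def)
    hence "shape g' (Suc m) = insert q \<nu>"
      using g'_Suc by (simp add: shape_Suc \<nu>_def insert_commute)
    hence q'_Suc: "pos \<kappa> s g' (Suc m) = end_of \<kappa> (insert q \<nu>) c"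
      using hit' by (simp add: pos_Suc g'_Suc)
    have out': "add_item \<kappa> s g' (Suc m) = pos \<kappa> s g' (Suc m)" using hit' by simp
    have yq: "young (insert q \<mu>)"
      using young_pos_item[OF f(1,3,6), of "\<not> \<kappa>" m] pq by (simp add: p'_def \<mu>_def)
    show ?thesis
    proof (cases "q = e")
      case False
      have "\<not> hit (\<not> \<kappa>) s' g m" using False ns' g_Suc by (simp add: hit_def q_def)
      hence "pos (\<not> \<kappa>) s' g (Suc m) = q" "add_item (\<not> \<kappa>) s' g (Suc m) = e"
        by (simp_all add: pos_Suc q_def g_Suc)
      moreover have "end_of \<kappa> (insert q \<nu>) c = e"
      proof (cases "q = (0, 0)")
        case True
        thus ?thesis using young_zero[OF y(2)] by (simp add: insert_absorb e_def)
      next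
        case q0: False
        hence "s' \<le> m" using pos_eq_zero[OF f(3), of "\<not> \<kappa>" f m] pq by (simp add: p'_def)
        hence "q \<notin> \<mu>" using pos_notin[OF f(1,3,6), of m "\<not> \<kappa>"] pq by (simp add: p'_def \<mu>_def)
        thus ?thesis
          using end_of_disjoint[OF y(1) y(2)[unfolded \<nu>_def] yq, of \<kappa>] False by (simp add: e_def \<nu>_def)
      qed
      ultimately show ?thesis
        using False unfolding commutes_at_def linked_def g_def[symmetric] g'_def[symmetric] out'
        by (simp add: p_Suc p'_Suc q'_Suc)
    next
      case True
      have "q \<noteq> (0, 0)" using True by (simp add: e_def)
      hence "hit (\<not> \<kappa>) s' g m" using True g_Suc by (simp add: hit_def q_def)
      hence q_Suc: "pos (\<not> \<kappa>) s' g (Suc m) = end_of (\<not> \<kappa>) (insert q \<nu>) q"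
          "add_item (\<not> \<kappa>) s' g (Suc m) = pos (\<not> \<kappa>) s' g (Suc m)"
        by (simp_all add: pos_Suc shape_g g_Suc True)
      note coll = end_of_collision[OF y(1) y(2)[unfolded \<nu>_def] y(3) yq
          True[unfolded e_def \<nu>_def], folded \<nu>_def]
      \<comment> \<open>The collision creates a domino: whichever item is added first holds q, the
        other one the cell next to it.\<close>
      have "linked e (mk_cell \<kappa> (line \<kappa> q) (Suc (line (\<not> \<kappa>) q))) q
          (mk_cell \<kappa> (line \<kappa> q) (Suc (line (\<not> \<kappa>) q)))"
        using True \<open>q \<noteq> (0, 0)\<close> unfolding linked_def by blast
      thus ?thesis
        unfolding commutes_at_def g_def[symmetric] g'_def[symmetric] out' q_Suc q'_Suc p_Suc p'_Suc coll
        by simp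
    qed
  next
    case True
    have p0: "p' = c" "p' \<noteq> (0, 0)"
      using True ns' by (auto simp: hit_def p'_def c_def)
    \<comment> \<open>Two items on one real cell exclude the first alternative of
      \<open>linked\<close>. The domino is resolved below: in both orders the \<kappa>-item ends on
      e and the other one on q.\<close>
    have pq: "p = p'" "q = q'" using linked p0 c unfolding linked_def by auto
    have q: "q = mk_cell \<kappa> (line \<kappa> c) (Suc (line (\<not> \<kappa>) c))"
      using dir[OF True] c by (simp add: q_def g_def p_def)
    have q0: "q \<noteq> (0, 0)" by (simp add: q)
    hence "s' \<le> m" using pos_eq_zero[OF f(3), of "\<not> \<kappa>" g m] by (simp add: q_def)
    hence yq: "young (insert q \<nu>)" "q \<notin> \<nu>"
      using young_pos_item[OF gg(1) f(3) gg(3), of "\<not> \<kappa>" m] pos_notin[OF gg(1) f(3) gg(3), of m "\<not> \<kappa>"]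
      by (simp_all add: q_def shape_g)
    note dom = end_of_domino[OF y(2) _ _ yq q]
    have dom: "end_of (\<not> \<kappa>) \<nu> c = q" "end_of \<kappa> (insert q \<nu>) q = e"
      using dom p0 by (simp_all add: e_def \<nu>_def)
    have "q \<noteq> e"
    proof
      assume "q = e"
      hence "line \<kappa> q = line \<kappa> e" by simp
      thus False by (simp add: q e_def)
    qed
    hence "\<not> hit (\<not> \<kappa>) s' g m" using ns' g_Suc by (simp add: hit_def q_def)
    hence q_Suc: "pos (\<not> \<kappa>) s' g (Suc m) = q" "add_item (\<not> \<kappa>) s' g (Suc m) = e"
      by (simp_all add: pos_Suc q_def g_Suc)
    have p'_Suc: "pos (\<not> \<kappa>) s' f (Suc m) = q" using True dom by (simp add: pos_Suc shape_f c_def)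
    have g'_Suc: "g' (Suc m) = q" using True p'_Suc by (simp add: g'_def)
    have hit': "hit \<kappa> s g' m" using q0 pq g'_Suc by (simp add: hit_def q'_def)
    have "shape g' (Suc m) = insert q \<nu>"
      using shape_add_item[OF f(1,3,6), of "\<not> \<kappa>" "Suc m"] p'_Suc by (simp add: g'_def shape_f)
    hence q'_Suc: "pos \<kappa> s g' (Suc m) = e" using hit' dom by (simp add: pos_Suc g'_Suc)
    have "add_item \<kappa> s g' (Suc m) = e" using hit' q'_Suc by simp
    thus ?thesis
      using \<open>q \<noteq> e\<close> unfolding commutes_at_def linked_def g_def[symmetric] g'_def[symmetric]
      by (simp add: p_Suc p'_Suc q_Suc q'_Suc del: add_item.simps)
  qed
qed


text \<open>Diagrams are closed towards the origin, so the outer cell of a domino cannot be added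
  while the inner one is missing.\<close>

lemma domino_notin_corner:
  assumes "young \<mu>" "young (insert q \<mu>)" "p \<notin> \<mu>" "young (insert p \<mu>)" "p \<noteq> (0, 0)"
    and q: "q = mk_cell \<kappa> (line \<kappa> p) (Suc (line (\<not> \<kappa>) p))"
  shows False
proof -
  obtain r j where p: "p = mk_cell \<kappa> r j" by (rule obtain_mk_cell)
  have rj: "0 < r \<and> 0 < j" using young_pos[OF assms(4), of \<kappa> r j] assms(5) by (auto simp: p)
  thus False
    using young_closed[OF assms(2), of \<kappa> r "Suc j" r j] assms(3) by (simp add: p q)
qed

text \<open>The item added second is not hit either: it stands where it would stand when added
  first, or on the outer cell of a domino, which f cannot take before the inner one.\<close>

lemma commutes_at_no_hit:
  assumes f: "growth f" "0 < s" "0 < s'" "s \<noteq> s'" "f s = (0, 0)" "f s' = (0, 0)"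
    and IH: "commutes_at \<kappa> s s' f m" and no_hit: "\<not> hit \<kappa> s f m" "\<not> hit (\<not> \<kappa>) s' f m"
  shows "commutes_at \<kappa> s s' f (Suc m)"
proof -
  define g where "g = add_item \<kappa> s f"
  define g' where "g' = add_item (\<not> \<kappa>) s' f"
  define p where "p = pos \<kappa> s f m"
  define q where "q = pos (\<not> \<kappa>) s' g m"
  define p' where "p' = pos (\<not> \<kappa>) s' f m"
  define q' where "q' = pos \<kappa> s g' m"
  define c where "c = f (Suc m)"
  have linked: "linked p q p' q'"
    using IH by (simp add: commutes_at_def p_def q_def p'_def q'_def g_def g'_def)
  have g: "g (Suc m) = c" "g' (Suc m) = c" using no_hit by (simp_all add: g_def g'_def c_def)
  have ns: "Suc m \<noteq> s" "Suc m \<noteq> s'" using no_hit by (auto simp: hit_def)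
  have q_ne: "q = c \<longrightarrow> q = (0, 0)" and q'_ne: "q' = c \<longrightarrow> q' = (0, 0)"
  proof -
    have "(q = c \<longrightarrow> q = (0, 0)) \<and> (q' = c \<longrightarrow> q' = (0, 0))"
    proof (cases "p = q' \<and> p' = q")
      case True
      thus ?thesis using no_hit by (auto simp: hit_def p_def p'_def c_def)
    next
      case False
      then obtain \<kappa>' where pq: "q = q'" "p \<noteq> (0, 0)"
          and q: "q = mk_cell \<kappa>' (line \<kappa>' p) (Suc (line (\<not> \<kappa>') p))"
        using linked unfolding linked_def by blast
      have "s \<le> m" using pos_eq_zero[OF f(2), of \<kappa> f m] pq by (simp add: p_def)
      hence "p \<notin> shape f m" "young (insert p (shape f m))"
        using pos_notin[OF f(1,2,5)] young_pos_item[OF f(1,2,5)] by (simp_all add: p_def)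
      hence "q \<noteq> c"
        using domino_notin_corner[OF growthD(2)[OF f(1), of m] _ _ _ pq(2) q] growthD(3)[OF f(1), of m]
        by (auto simp: c_def)
      thus ?thesis using pq by simp
    qed
    thus "q = c \<longrightarrow> q = (0, 0)" "q' = c \<longrightarrow> q' = (0, 0)" by simp_all
  qed
  have "\<not> hit (\<not> \<kappa>) s' g m" "\<not> hit \<kappa> s g' m"
    using ns q_ne q'_ne g by (auto simp: hit_def q_def q'_def)
  thus ?thesis
    using no_hit g linked unfolding commutes_at_def g_def[symmetric] g'_def[symmetric]
    by (simp add: pos_Suc p_def q_def p'_def q'_def)
qed

lemma commutes_at:
  assumes f: "growth f" "0 < s" "0 < s'" "s \<noteq> s'" "f s = (0, 0)" "f s' = (0, 0)"
  shows "commutes_at \<kappa> s s' f m"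
proof (induction m)
  case 0
  show ?case by (simp add: commutes_at_def linked_def)
next
  case (Suc m)
  note sym = Suc[THEN commutes_at_sym]
  show ?case
  proof (cases "hit \<kappa> s f m"; cases "hit (\<not> \<kappa>) s' f m")
    assume hit: "hit \<kappa> s f m" "hit (\<not> \<kappa>) s' f m"
    define p where "p = pos \<kappa> s f m"
    define q where "q = pos (\<not> \<kappa>) s' (add_item \<kappa> s f) m"
    have p': "pos (\<not> \<kappa>) s' f m = p"
      using hit_pos[OF f(2,5) hit(1)] hit_pos[OF f(3,6) hit(2)] by (simp add: p_def)
    have "p \<noteq> (0, 0)" using f(4) hit p' by (auto simp: hit_def p_def)
    \<comment> \<open>Both items stand on the inner cell of a domino. Its direction \<kappa>'
      decides which of them takes the first role in \<open>commutes_at_hit\<close>.\<close>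
    then obtain \<kappa>' where q: "q = mk_cell \<kappa>' (line \<kappa>' p) (Suc (line (\<not> \<kappa>') p))"
        "pos \<kappa> s (add_item (\<not> \<kappa>) s' f) m = q"
      using Suc p' unfolding commutes_at_def linked_def p_def[symmetric] q_def[symmetric] by metis
    show ?thesis
    proof (cases "\<kappa>' = \<kappa>")
      case True
      show ?thesis
        by (rule commutes_at_hit[OF f Suc hit(1)]) (use q(1) True in \<open>simp add: p_def q_def\<close>)
    next
      case False
      hence "\<kappa>' = (\<not> \<kappa>)" by auto
      hence "commutes_at (\<not> \<kappa>) s' s f (Suc m)"
        using q p' f by (intro commutes_at_hit[OF f(1,3,2) _ f(6,5) sym hit(2)]) simp_all
      thus ?thesis using commutes_at_sym by fastforce
    qed
  next
    assume "hit \<kappa> s f m" "\<not> hit (\<not> \<kappa>) s' f m"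
    thus ?thesis using commutes_at_hit[OF f Suc] by blast
  next
    assume hit: "\<not> hit \<kappa> s f m" "hit (\<not> \<kappa>) s' f m"
    hence "commutes_at (\<not> \<kappa>) s' s f (Suc m)"
      using f by (intro commutes_at_hit[OF f(1,3,2) _ f(6,5) sym hit(2)]) simp_all
    thus ?thesis using commutes_at_sym by fastforce
  next
    assume "\<not> hit \<kappa> s f m" "\<not> hit (\<not> \<kappa>) s' f m"
    thus ?thesis by (rule commutes_at_no_hit[OF f Suc])
  qed
qed

lemma add_item_commute:
  assumes f: "growth f" "0 < s" "0 < s'" "s \<noteq> s'" "f s = (0, 0)" "f s' = (0, 0)"
  shows "add_item (\<not> \<kappa>) s' (add_item \<kappa> s f) = add_item \<kappa> s (add_item (\<not> \<kappa>) s' f)"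
  using commutes_at[OF assms, of \<kappa>] by (auto simp: commutes_at_def)

section \<open>Copies of one letter\<close>

lemma older_below:
  assumes f: "growth f" "0 < s" "f s = (0, 0)" "f s' = (0, 0)" "s < s'" and m: "s' \<le> m"
  shows "line \<kappa> (pos \<kappa> s' (add_item \<kappa> s f) m) \<le> line \<kappa> (pos \<kappa> s f m)"
  using m
proof (induction m rule: dec_induct)
  case base
  define g where "g = add_item \<kappa> s f"
  obtain m where m: "s' = Suc m" using f(5) by (cases s') auto
  have g0: "g s' = (0, 0)" using add_item_zero[OF f(1-4), of \<kappa>] f(5) by (simp add: g_def)
  have "line \<kappa> (pos \<kappa> s' g s') = Suc 0" using g0 by (simp add: m pos_Suc hit_def)
  moreover have "0 < line \<kappa> (pos \<kappa> s f s')"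
    using pos_eq_zero[OF f(2), of \<kappa> f s'] f(5) young_pos_item[OF f(1-3), of \<kappa> s']
      young_pos[of "insert (pos \<kappa> s f s') (shape f s')" \<kappa> "line \<kappa> (pos \<kappa> s f s')" "line (\<not> \<kappa>) (pos \<kappa> s f s')"]
    by (metis gr0I insertI1 line_zero mk_cell_eq_zero(1) mk_cell_line not_less_iff_gr_or_eq)
  ultimately show ?case by (simp add: g_def)
next
  case (step m)
  define g where "g = add_item \<kappa> s f"
  define p where "p = pos \<kappa> s f m"
  define q where "q = pos \<kappa> s' g m"
  have g: "growth g" "g s' = (0, 0)"
    using growth_add_item[OF f(1-3)] add_item_zero[OF f(1-4)] f(5) by (simp_all add: g_def)
  have IH: "line \<kappa> q \<le> line \<kappa> p" using step by (simp add: p_def q_def g_def)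
  have p_Suc: "pos \<kappa> s f (Suc m) = (if hit \<kappa> s f m then end_of \<kappa> (shape f (Suc m)) p else p)"
    using hit_pos[of s f \<kappa> m] f(2,3) by (simp add: pos_Suc p_def)
  have q_Suc: "pos \<kappa> s' g (Suc m) = (if hit \<kappa> s' g m then end_of \<kappa> (shape g (Suc m)) q else q)"
    using hit_pos[of s' g \<kappa> m] g(2) f(5) by (simp add: pos_Suc q_def)
  show ?case
  proof (cases "hit \<kappa> s f m \<or> \<not> hit \<kappa> s' g m")
    case True
    thus ?thesis using IH unfolding g_def[symmetric] by (auto simp: p_Suc q_Suc)
  next
    case False
    have q: "q = f (Suc m)" "q \<noteq> (0, 0)"
      using False step by (auto simp: hit_def q_def g_def)
    have p0: "p \<noteq> (0, 0)" using pos_eq_zero[OF f(2), of \<kappa> f m] step f(5) by (simp add: p_def)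
    have "p \<noteq> q" using False q p0 by (auto simp: hit_def p_def)
    obtain i where i: "p = mk_cell \<kappa> (line \<kappa> p) i" by (metis mk_cell_line)
    obtain j where j: "q = mk_cell \<kappa> (line \<kappa> q) j" by (metis mk_cell_line)
    have "line \<kappa> p \<noteq> line \<kappa> q"
    proof
      assume eq: "line \<kappa> p = line \<kappa> q"
      have "young (insert p (shape f m))" "p \<notin> shape f m" "young (insert q (shape f m))" "q \<notin> shape f m"
        using young_pos_item[OF f(1-3), of \<kappa> m] pos_notin[OF f(1-3), of m \<kappa>] step f(5)
          growthD(3,4)[OF f(1), of m] q by (simp_all add: p_def)
      moreover have "0 < line \<kappa> p"
        using young_pos[of "insert p (shape f m)" \<kappa> "line \<kappa> p" i] calculation(1) i p0
        by (metis gr0I insertI1 mk_cell_eq_zero(1))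
      ultimately have "i = j" using addable_unique[of \<kappa> "line \<kappa> p" i "shape f m" j] i j eq by metis
      thus False using \<open>p \<noteq> q\<close> i j eq by metis
    qed
    thus ?thesis using False IH unfolding g_def[symmetric] by (simp add: p_Suc q_Suc)
  qed
qed

text \<open>The newer item, which is the smaller one here, pushes the older one on whenever it
  enters its line.\<close>

lemma newer_above:
  assumes f: "growth f" "0 < s" "0 < s'" "f s = (0, 0)" "f s' = (0, 0)" "s' < s" and m: "s \<le> m"
  shows "line \<kappa> (pos \<kappa> s f m) < line \<kappa> (pos \<kappa> s' (add_item \<kappa> s f) m)"
proof -
  define g where "g = add_item \<kappa> s f"
  have g: "growth g" "g s' = (0, 0)"
    using growth_add_item[OF f(1,2,4)] add_item_zero[OF f(1,2,4,5)] f(6) by (simp_all add: g_def)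
  have mono: "line \<kappa> (pos \<kappa> s' g m) \<le> line \<kappa> (pos \<kappa> s' g (Suc m))" for m
    using hit_pos[of s' g \<kappa> m] f(3) g(2) by (auto simp: pos_Suc)
  have bump: "Suc (line \<kappa> (pos \<kappa> s f m)) < line \<kappa> (pos \<kappa> s' g (Suc m))"
    if hit: "hit \<kappa> s f m" and less: "line \<kappa> (pos \<kappa> s f m) < line \<kappa> (pos \<kappa> s' g m)" and m: "s' \<le> m" for m
  proof -
    define p where "p = pos \<kappa> s f m"
    define q where "q = pos \<kappa> s' g m"
    define e where "e = pos \<kappa> s f (Suc m)"
    have e: "e = end_of \<kappa> (shape f (Suc m)) p" "f (Suc m) = p"
      using hit hit_pos[of s f \<kappa> m] f(2,4) by (simp_all add: e_def p_def pos_Suc)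
    have sh: "shape g m = shape f (Suc m)"
      using e(2) shape_add_item[OF f(1,2,4), of \<kappa> m] by (simp add: g_def p_def shape_Suc)
    have q: "young (insert q (shape g m))" "q \<notin> shape g m"
      using young_pos_item[OF g(1) f(3) g(2)] pos_notin[OF g(1) f(3) g(2) m] by (simp_all add: q_def)
    have e': "young (insert e (shape g m))" "e \<notin> shape g m"
      using young_insert_end_of[OF growthD(2-4)[OF f(1), of m], of \<kappa>]
        end_of_notin[OF growthD(2)[OF f(1), of "Suc m"], of \<kappa> p] e(2)
      by (simp_all add: e sh[unfolded shape_Suc] shape_Suc sh)
    \<comment> \<open>If the older item is in the line being entered, q and e are both addable cells
      of that line and therefore equal.\<close>
    have "q = e \<or> Suc (line \<kappa> p) < line \<kappa> q"
    proof (rule disjCI)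
      assume "\<not> Suc (line \<kappa> p) < line \<kappa> q"
      hence eq: "line \<kappa> q = Suc (line \<kappa> p)" using less by (simp add: p_def q_def)
      obtain i where i: "q = mk_cell \<kappa> (Suc (line \<kappa> p)) i" by (metis mk_cell_line eq)
      obtain j where j: "e = mk_cell \<kappa> (Suc (line \<kappa> p)) j" by (metis mk_cell_line e(1) line_end_of)
      show "q = e"
        using addable_unique[of \<kappa> "Suc (line \<kappa> p)" i "shape g m" j] q e' unfolding i j by simp
    qed
    thus ?thesis
    proof
      assume qe: "q = e"
      have "g (Suc m) = e" using hit by (simp add: g_def e_def)
      moreover have "e \<noteq> (0, 0)" by (simp add: e)
      ultimately have "hit \<kappa> s' g m" using qe by (simp add: hit_def q_def)
      hence "line \<kappa> (pos \<kappa> s' g (Suc m)) = Suc (line \<kappa> e)"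
        using \<open>g (Suc m) = e\<close> by (simp add: pos_Suc)
      thus ?thesis by (simp add: e p_def)
    next
      assume "Suc (line \<kappa> p) < line \<kappa> q"
      thus ?thesis using mono[of m] by (simp add: p_def q_def)
    qed
  qed
  have pos: "0 < line \<kappa> (pos \<kappa> s' g m)" if "s' \<le> m" for m
    using that
  proof (induction m rule: dec_induct)
    case base
    show ?case using f(3) by (cases s') (simp_all add: pos_Suc hit_def)
  next
    case (step m)
    thus ?case using mono[of m] by simp
  qed
  show ?thesis
    using m unfolding g_def[symmetric]
  proof (induction m rule: dec_induct)
    case base
    obtain m where m: "s = Suc m" using f(2) by (cases s) auto
    have p: "pos \<kappa> s f m = (0, 0)" using pos_eq_zero[OF f(2), of \<kappa> f m] by (simp add: m)
    have hit: "hit \<kappa> s f m" by (simp add: hit_def m)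
    have "Suc 0 < line \<kappa> (pos \<kappa> s' g s)"
      using bump[OF hit] pos[of m] f(6) p by (simp add: m)
    thus ?case using hit hit_pos[OF f(2,4) hit] p by (simp add: m pos_Suc)
  next
    case (step m)
    show ?case
    proof (cases "hit \<kappa> s f m")
      case True
      thus ?thesis using bump[OF True] step f(6) hit_pos[OF f(2,4) True] by (simp add: pos_Suc)
    next
      case False
      thus ?thesis using step mono[of m] by (simp add: pos_Suc)
    qed
  qed
qed

section \<open>Lists of items\<close>

definition add_items :: "(nat \<Rightarrow> bool) \<Rightarrow> nat list \<Rightarrow> path \<Rightarrow> path" where
  "add_items \<kappa> L = fold (\<lambda>s. add_item (\<kappa> s) s) L"

lemma add_items_simps [simp]:
  "add_items \<kappa> [] f = f"
  "add_items \<kappa> (s # L) f = add_items \<kappa> L (add_item (\<kappa> s) s f)"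
  by (simp_all add: add_items_def)

lemma add_items_snoc: "add_items \<kappa> (L @ [s]) f = add_item (\<kappa> s) s (add_items \<kappa> L f)"
  by (simp add: add_items_def)

definition fresh_items :: "nat list \<Rightarrow> path \<Rightarrow> bool" where
  "fresh_items L f \<longleftrightarrow> growth f \<and> distinct L \<and> (\<forall>s \<in> set L. 0 < s \<and> f s = (0, 0))"

lemma fresh_items_Cons:
  assumes "fresh_items (s # L) f"
  shows "growth f" "0 < s" "f s = (0, 0)" "s \<notin> set L" "fresh_items L f"
    "fresh_items L (add_item \<kappa> s f)"
proof -
  show *: "growth f" "0 < s" "f s = (0, 0)" "s \<notin> set L" "fresh_items L f"
    using assms by (simp_all add: fresh_items_def)
  show "fresh_items L (add_item \<kappa> s f)"
    using * growth_add_item[OF *(1-3)] add_item_eq_zero[OF *(1-3)]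
    by (auto simp: fresh_items_def)
qed

lemma add_items_growth:
  assumes "fresh_items L f"
  shows "growth (add_items \<kappa> L f) \<and> (\<forall>m. add_items \<kappa> L f m = (0, 0) \<longleftrightarrow> m \<notin> set L \<and> f m = (0, 0))"
  using assms
proof (induction L arbitrary: f)
  case Nil
  thus ?case by (simp add: fresh_items_def)
next
  case (Cons s L)
  note s = fresh_items_Cons[OF Cons.prems]
  show ?case
    using Cons.IH[OF s(6)[of "\<kappa> s"]] add_item_eq_zero[OF s(1-3)] by auto
qed

lemma add_items_opposite:
  assumes "fresh_items (s # L) f" "\<forall>x \<in> set L. \<kappa> x = (\<not> \<tau>)"
  shows "add_items \<kappa> L (add_item \<tau> s f) = add_item \<tau> s (add_items \<kappa> L f)"
  using assms
proof (induction L arbitrary: f)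
  case (Cons x L)
  have x: "growth f" "0 < x" "f x = (0, 0)" "0 < s" "f s = (0, 0)" "s \<noteq> x" "\<kappa> x = (\<not> \<tau>)"
    using Cons.prems by (auto simp: fresh_items_def)
  have "fresh_items (s # L) (add_item (\<not> \<tau>) x f)"
    using fresh_items_Cons(6)[of x "s # L" f "\<not> \<tau>"] Cons.prems(1) by (auto simp: fresh_items_def)
  from Cons.IH[OF this] show ?case
    using add_item_commute[OF x(1,4,2,6,5,3), of \<tau>] x(7) Cons.prems(2) by simp
qed simp

text \<open>A normal form that forgets how row items and column items are interleaved, which is all
  that the choice of the shuffle influences.\<close>

lemma add_items_partition:
  assumes "fresh_items L f"
  shows "add_items \<kappa> L f =
    add_items \<kappa> (filter (\<lambda>s. \<not> \<kappa> s) L) (add_items \<kappa> (filter \<kappa> L) f)"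
  using assms
proof (induction L arbitrary: f)
  case (Cons s L)
  note s = fresh_items_Cons[OF Cons.prems]
  show ?case
  proof (cases "\<kappa> s")
    case True
    thus ?thesis using Cons.IH[OF s(6)] by simp
  next
    case False
    have "fresh_items (s # filter \<kappa> L) f"
      using Cons.prems by (simp add: fresh_items_def)
    hence "add_items \<kappa> (filter \<kappa> L) (add_item False s f) = add_item False s (add_items \<kappa> (filter \<kappa> L) f)"
      by (rule add_items_opposite) simp
    thus ?thesis using False Cons.IH[OF s(6), of False] by simp
  qed
qed simp

section \<open>The insertion algorithm follows the growth paths\<close>

definition is_t :: "letter \<Rightarrow> bool" where
  "is_t x \<longleftrightarrow> (\<exists>i. x = T i)"

lemma is_t_simps [simp]: "is_t (T i)" "\<not> is_t (U i)"
  by (simp_all add: is_t_def)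

lemma next_line_eq: "next_line c x = Suc (line (is_t x) c)"
  by (cases c; cases x) (simp_all add: line_def)

lemma landing_cell_eq:
  "landing_cell A \<epsilon> \<delta> P x s =
     (let bumpable = (\<lambda>j. \<exists>z. P (mk_cell (is_t x) s j) = Some z \<and>
            can_bump (if is_t x then \<epsilon> else \<delta>) A x z)
      in mk_cell (is_t x) s (if \<exists>j. bumpable j then LEAST j. bumpable j
             else Suc (card {j. mk_cell (is_t x) s j \<in> dom P})))"
  by (cases x) (simp_all add: mk_cell_def sh_def Let_def cong: if_cong)

text \<open>Covers a bump and a new cell at once. If e is empty, \<open>full\<close> also excludes
  entries beyond e, so that nothing is bumpable and the count leads to e.\<close>

lemma landing_cell_eqI:
  assumes x: "is_t x = \<kappa>" "(if is_t x then \<epsilon> else \<delta>) = \<beta>"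
    and low: "\<And>j z. P (mk_cell \<kappa> s j) = Some z \<Longrightarrow> j < e \<Longrightarrow> \<not> can_bump \<beta> A x z"
    and at: "\<And>z. P (mk_cell \<kappa> s e) = Some z \<Longrightarrow> can_bump \<beta> A x z"
    and full: "P (mk_cell \<kappa> s e) = None \<Longrightarrow> {j. mk_cell \<kappa> s j \<in> dom P} = {1..<e}"
    and "0 < e"
  shows "landing_cell A \<epsilon> \<delta> P x s = mk_cell \<kappa> s e"
proof -
  define bumpable where "bumpable = (\<lambda>j. \<exists>z. P (mk_cell \<kappa> s j) = Some z \<and> can_bump \<beta> A x z)"
  have eq: "landing_cell A \<epsilon> \<delta> P x s = mk_cell \<kappa> s (if \<exists>j. bumpable j then LEAST j. bumpable j
             else Suc (card {j. mk_cell \<kappa> s j \<in> dom P}))"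
    unfolding landing_cell_eq x(2) unfolding x(1) bumpable_def Let_def ..
  have low': "e \<le> j" if "bumpable j" for j
    using low that unfolding bumpable_def by (meson not_le)
  show ?thesis
  proof (cases "P (mk_cell \<kappa> s e)")
    case None
    have no: "\<not> (\<exists>j. bumpable j)"
    proof
      assume "\<exists>j. bumpable j"
      then obtain j where b: "bumpable j" ..
      hence "j \<in> {j. mk_cell \<kappa> s j \<in> dom P}" by (auto simp: bumpable_def)
      thus False using low'[OF b] full[OF None] by simp
    qed
    thus ?thesis unfolding eq if_not_P[OF no] using full[OF None] \<open>0 < e\<close> by simp
  next
    case (Some z)
    hence b: "bumpable e" using at by (simp add: bumpable_def)
    have "(LEAST j. bumpable j) = e" by (rule Least_equality) (use b low' in auto)
    thus ?thesis unfolding eq using b by auto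
  qed
qed

text \<open>Being tail recursive, \<open>insert_from\<close> satisfies its equation without a
  termination proof. It is unfolded once per item that moves.\<close>

lemma insert_from_step:
  "landing_cell A \<epsilon> \<delta> P x s = c \<Longrightarrow> insert_from A \<epsilon> \<delta> P x s =
     (case P c of None \<Rightarrow> (P(c \<mapsto> x), c)
      | Some z \<Rightarrow> insert_from A \<epsilon> \<delta> (P(c \<mapsto> x)) z (next_line c z))"
  by (subst insert_from.simps) (simp add: Let_def)

text \<open>\<open>w s\<close> is the letter at time \<open>s\<close>, and \<open>L\<close> lists the times in increasing order of items.\<close>

locale item_order =
  fixes A :: "letter rel" and \<epsilon> \<delta> :: variant and w :: "nat \<Rightarrow> letter" and L :: "nat list" and n :: nat
  assumes distinct: "distinct L" and set_L: "set L = {1..n}"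
    and order: "\<And>i j. i < j \<Longrightarrow> j < n \<Longrightarrow> (w (L ! i), w (L ! j)) \<in> A \<or> w (L ! i) = w (L ! j) \<and>
        (if (if is_t (w (L ! i)) then \<epsilon> else \<delta>) = Regular then L ! i < L ! j else L ! j < L ! i)"
    and asym: "\<And>x y. (x, y) \<in> A \<Longrightarrow> (y, x) \<notin> A"
begin

section \<open>Paths and cells of the sorted items\<close>

abbreviation kind :: "nat \<Rightarrow> bool" where
  "kind s \<equiv> is_t (w s)"

definition F :: "nat \<Rightarrow> path" where
  "F i = add_items kind (take i L) (\<lambda>_. (0, 0))"

text \<open>Larger items never move item i, so \<open>F i\<close> already determines its cell in the
  full tableau.\<close>

definition p :: "nat \<Rightarrow> nat \<Rightarrow> cell" where
  "p i m = pos (kind (L ! i)) (L ! i) (F i) m"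

lemma length_L: "length L = n"
  using distinct_card[OF distinct] by (simp add: set_L)

lemma F_0 [simp]: "F 0 = (\<lambda>_. (0, 0))"
  by (simp add: F_def)

lemma F_Suc: "i < n \<Longrightarrow> F (Suc i) = add_item (kind (L ! i)) (L ! i) (F i)"
  by (simp add: F_def take_Suc_conv_app_nth length_L add_items_snoc)

lemma nth_L: "i < n \<Longrightarrow> 0 < L ! i" "i < n \<Longrightarrow> L ! i \<le> n"
  using set_L length_L nth_mem[of i L] by (auto simp: Suc_le_eq)

lemma fresh_L: "fresh_items L (\<lambda>_. (0, 0))"
  by (auto simp: fresh_items_def distinct set_L growth_def shape_def young_def image_constant_conv)

lemma growth_F: "growth (F i)"
  and F_eq_zero: "F i m = (0, 0) \<longleftrightarrow> m \<notin> set (take i L)"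
proof -
  have "fresh_items (take i L) (\<lambda>_. (0, 0))"
    using fresh_L by (auto simp: fresh_items_def dest: in_set_takeD)
  from add_items_growth[OF this]
  show "growth (F i)" "F i m = (0, 0) \<longleftrightarrow> m \<notin> set (take i L)"
    by (simp_all add: F_def)
qed

lemma F_item: "i \<le> j \<Longrightarrow> j < n \<Longrightarrow> F i (L ! j) = (0, 0)"
  unfolding F_eq_zero using nth_eq_iff_index_eq[OF distinct]
  by (auto simp: length_L in_set_conv_nth)

lemma item: "i < n \<Longrightarrow> growth (F i)" "i < n \<Longrightarrow> 0 < L ! i" "i < n \<Longrightarrow> F i (L ! i) = (0, 0)"
  by (simp_all add: growth_F nth_L F_item)

lemma shape_F_Suc: "i < n \<Longrightarrow> shape (F (Suc i)) m = insert (p i m) (shape (F i) m)"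
  by (simp add: F_Suc p_def shape_add_item[OF item])

lemma p_notin: "i < n \<Longrightarrow> L ! i \<le> m \<Longrightarrow> p i m \<notin> shape (F i) m"
  by (simp add: p_def pos_notin[OF item])

lemma p_eq_zero: "i < n \<Longrightarrow> p i m = (0, 0) \<longleftrightarrow> m < L ! i"
  by (simp add: p_def pos_eq_zero nth_L)

lemma shape_F_mono: "i \<le> j \<Longrightarrow> j \<le> n \<Longrightarrow> shape (F i) m \<subseteq> shape (F j) m"
  by (induction j rule: dec_induct) (auto simp: shape_F_Suc)

lemma p_in_shape: "i < j \<Longrightarrow> j \<le> n \<Longrightarrow> p i m \<in> shape (F j) m"
  using shape_F_mono[of "Suc i" j m] by (auto simp: shape_F_Suc)

section \<open>Positions of equal letters under the two tie rules\<close>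

definition version :: "nat \<Rightarrow> variant" where
  "version s = (if kind s then \<epsilon> else \<delta>)"

lemma order_cases:
  assumes "i < j" "j < n"
  obtains "(w (L ! i), w (L ! j)) \<in> A" "w (L ! i) \<noteq> w (L ! j)" "(w (L ! j), w (L ! i)) \<notin> A"
  | "w (L ! i) = w (L ! j)" "version (L ! i) = Regular" "L ! i < L ! j"
  | "w (L ! i) = w (L ! j)" "version (L ! i) = Dual" "L ! j < L ! i"
proof -
  have "version (L ! i) = Regular \<or> version (L ! i) = Dual" by (metis variant.exhaust)
  thus ?thesis
    using order[OF assms] asym[of "w (L ! i)" "w (L ! j)"] that unfolding version_def
    by (metis variant.distinct(1))
qed

lemma irrefl: "(x, x) \<notin> A"
  using asym by blast

text \<open>For copies i < j of one letter: a regular insertion of i must not meet j in the line it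
  enters, since it would pass over j; under the dual rule i and j must not share a line, since j
  would bump i. The bounds on m say that both copies are present.\<close>

definition below :: "nat \<Rightarrow> nat \<Rightarrow> bool" where
  "below i j \<longleftrightarrow>
    (version (L ! i) = Regular \<longrightarrow>
      L ! i < L ! j \<and> (\<forall>m \<ge> L ! j. line (kind (L ! i)) (p j m) \<le> line (kind (L ! i)) (p i m))) \<and>
    (version (L ! i) = Dual \<longrightarrow>
      L ! j < L ! i \<and> (\<forall>m \<ge> L ! i. line (kind (L ! i)) (p i m) < line (kind (L ! i)) (p j m)))"

lemma below_Suc:
  assumes "Suc i < n" "w (L ! i) = w (L ! Suc i)"
  shows "below i (Suc i)"
proof -
  have i: "i < n" using assms by simp
  have kind: "kind (L ! Suc i) = kind (L ! i)" using assms by simp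
  note g = item[OF i] F_item[of i "Suc i"] nth_L(1)[OF assms(1)]
  show ?thesis
  proof (rule order_cases[OF lessI assms(1)])
    assume "version (L ! i) = Regular" "L ! i < L ! Suc i"
    thus ?thesis
      using older_below[OF g(1-3), of "L ! Suc i" _ "kind (L ! i)"] g(4) assms(1)
      by (simp add: below_def p_def F_Suc[OF i] kind)
  next
    assume "version (L ! i) = Dual" "L ! Suc i < L ! i"
    thus ?thesis
      using newer_above[OF g(1,2,5,3) _ _, of _ "kind (L ! i)"] g(4) assms(1)
      by (simp add: below_def p_def F_Suc[OF i] kind)
  qed (use assms irrefl in auto)
qed

text \<open>\<open>older_below\<close> and \<open>newer_above\<close> compare an item only with the
  next one; copies farther apart are reached by transitivity.\<close>

lemma below_copies:
  assumes "i < j" "j < n" "w (L ! i) = w (L ! j)"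
  shows "below i j"
  using assms
proof (induction j)
  case (Suc j)
  show ?case
  proof (cases "i = j")
    case True
    thus ?thesis using below_Suc Suc.prems by simp
  next
    case False
    hence ij: "i < j" "j < n" using Suc.prems by simp_all
    \<comment> \<open>Copies of a letter are consecutive items: a different letter in between would
      be both above and below it.\<close>
    have w: "w (L ! i) = w (L ! j)"
    proof (rule ccontr)
      assume ne: "w (L ! i) \<noteq> w (L ! j)"
      have "(w (L ! i), w (L ! j)) \<in> A" using ne by (rule_tac order_cases[OF ij]) simp_all
      moreover have "(w (L ! j), w (L ! Suc j)) \<in> A"
        using ne Suc.prems by (rule_tac order_cases[OF lessI Suc.prems(2)]) simp_all
      ultimately show False using asym Suc.prems(3) by simp
    qed
    have ij': "below i j" "below j (Suc j)"
      using Suc.IH[OF ij w] below_Suc[OF Suc.prems(2)] w Suc.prems(3) by simp_all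
    have same: "version (L ! j) = version (L ! i)" "w (L ! j) = w (L ! i)"
      using w by (simp_all add: version_def)
    show ?thesis
    proof (cases "version (L ! i)")
      case Regular
      thus ?thesis using ij' unfolding below_def same by (auto intro: le_trans)
    next
      case Dual
      thus ?thesis using ij' unfolding below_def same by (auto intro: less_trans)
    qed
  qed
qed simp

section \<open>Fillings before, during and after one insertion\<close>

primrec N :: "nat \<Rightarrow> nat \<Rightarrow> letter filling" where
  "N 0 m = Map.empty"
| "N (Suc i) m = (if L ! i \<le> m then (N i m)(p i m \<mapsto> w (L ! i)) else N i m)"

lemma N_Some: "N i m c = Some x \<Longrightarrow> \<exists>j < i. L ! j \<le> m \<and> p j m = c \<and> w (L ! j) = x"
  by (induction i) (auto split: if_splits intro: less_SucI)

lemma dom_N: "i \<le> n \<Longrightarrow> dom (N i m) = shape (F i) m - {(0, 0)}"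
proof (induction i)
  case 0
  thus ?case by (auto simp: shape_def)
next
  case (Suc i)
  hence i: "i < n" "dom (N i m) = shape (F i) m - {(0, 0)}" by simp_all
  show ?case
  proof (cases "L ! i \<le> m")
    case True
    hence "p i m \<noteq> (0, 0)" using p_eq_zero[OF i(1), of m] by simp
    thus ?thesis using True i by (simp add: shape_F_Suc insert_Diff_if dom_fun_upd del: fun_upd_apply)
  next
    case False
    hence "p i m = (0, 0)" using p_eq_zero[OF i(1), of m] by simp
    thus ?thesis using False i by (simp add: shape_F_Suc)
  qed
qed

lemma N_p:
  assumes "i < j" "j \<le> n" "L ! i \<le> m"
  shows "N j m (p i m) = Some (w (L ! i))"
  using assms
proof (induction j)
  case (Suc j)
  show ?case
  proof (cases "i = j")
    case True
    thus ?thesis using Suc.prems by simp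
  next
    case False
    hence ij: "i < j" "j < n" using Suc.prems by simp_all
    hence "L ! j \<le> m \<Longrightarrow> p i m \<noteq> p j m" using p_in_shape[of i j m] p_notin[of j m] by auto
    thus ?thesis using Suc.IH ij Suc.prems by simp
  qed
qed simp

text \<open>The filling halfway through the insertion at time \<open>m + 1\<close>: the \<open>i\<close> smallest items have
  already moved, and the last one that moved hides the item it is about to bump.\<close>

definition M :: "nat \<Rightarrow> nat \<Rightarrow> letter filling" where
  "M i m = N n m ++ N i (Suc m)"

definition hits :: "nat \<Rightarrow> nat \<Rightarrow> bool" where
  "hits i m \<longleftrightarrow> hit (kind (L ! i)) (L ! i) (F i) m"

lemma hits_iff: "hits i m \<longleftrightarrow> Suc m = L ! i \<or> p i m \<noteq> (0, 0) \<and> p i m = F i (Suc m)"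
  by (simp add: hits_def hit_def p_def)

lemma hits_p: "i < n \<Longrightarrow> hits i m \<Longrightarrow> p i m = F i (Suc m)"
  using hit_pos[of "L ! i" "F i" "kind (L ! i)" m] item[of i] by (simp add: hits_def p_def)

lemma F_hit:
  assumes "i < n" "hits i m"
  shows "F (Suc i) (Suc m) = end_of (kind (L ! i)) (shape (F i) (Suc m)) (F i (Suc m))"
    and "p i (Suc m) = F (Suc i) (Suc m)" and "L ! i \<le> Suc m"
proof -
  show "L ! i \<le> Suc m" using assms p_eq_zero[of i m] by (auto simp: hits_iff)
qed (use assms in \<open>simp_all add: F_Suc hits_def p_def pos_Suc\<close>)

lemma F_no_hit:
  assumes "i < n" "\<not> hits i m"
  shows "F (Suc i) (Suc m) = F i (Suc m)" "p i (Suc m) = p i m"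
  using assms by (simp_all add: F_Suc hits_def p_def pos_Suc)

lemma M_hit: "i < n \<Longrightarrow> hits i m \<Longrightarrow> M (Suc i) m = (M i m)(F (Suc i) (Suc m) \<mapsto> w (L ! i))"
  using F_hit[of i m] by (simp add: M_def)

lemma M_no_hit:
  assumes "i < n" "\<not> hits i m"
  shows "M (Suc i) m = M i m"
proof (cases "L ! i \<le> Suc m")
  case True
  have le: "L ! i \<le> m" using True assms by (auto simp: hits_iff)
  have "p i (Suc m) \<notin> dom (N i (Suc m))"
    using p_notin[OF assms(1) True] dom_N[of i "Suc m"] assms(1) by simp
  hence "M i m (p i (Suc m)) = Some (w (L ! i))"
    using N_p[OF assms(1) order.refl le] F_no_hit[OF assms] by (simp add: M_def map_add_dom_app_simps)
  hence "(M i m)(p i (Suc m) \<mapsto> w (L ! i)) = M i m" by (rule map_upd_triv)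
  thus ?thesis using True by (simp add: M_def)
qed (simp add: M_def)

text \<open>In the line that item i enters, the cells before e hold smaller items in their new
  places, and e is empty or holds a larger item in its old place. Different letters then compare as
  the items do; only ties need \<open>below_copies\<close>.\<close>

lemma landing_cell_M:
  assumes "i < n" "hits i m"
  shows "landing_cell A \<epsilon> \<delta> (M i m) (w (L ! i)) (next_line (F i (Suc m)) (w (L ! i))) = F (Suc i) (Suc m)"
proof -
  define \<kappa> where "\<kappa> = kind (L ! i)"
  define c where "c = F i (Suc m)"
  define \<nu> where "\<nu> = shape (F i) (Suc m)"
  have y: "young \<nu>" using growthD(2)[OF growth_F] by (simp add: \<nu>_def)
  obtain e where e: "0 < e" "end_of \<kappa> \<nu> c = mk_cell \<kappa> (Suc (line \<kappa> c)) e"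
      "\<And>j. mk_cell \<kappa> (Suc (line \<kappa> c)) j \<in> \<nu> \<longleftrightarrow> 0 < j \<and> j < e"
    using end_ofE[OF y, of \<kappa> c thesis] by blast
  have F: "F (Suc i) (Suc m) = mk_cell \<kappa> (Suc (line \<kappa> c)) e"
    using F_hit(1)[OF assms] e(2) by (simp add: \<kappa>_def c_def \<nu>_def)
  have pi: "p i m = c" "p i (Suc m) = mk_cell \<kappa> (Suc (line \<kappa> c)) e"
    using hits_p[OF assms] F_hit(2)[OF assms] F by (simp_all add: c_def)
  have dom: "dom (M i m) = (shape (F n) m \<union> \<nu>) - {(0, 0)}"
    using dom_N[of i "Suc m"] dom_N[of n m] assms(1) by (auto simp: M_def \<nu>_def)
  have "landing_cell A \<epsilon> \<delta> (M i m) (w (L ! i)) (Suc (line \<kappa> c)) = mk_cell \<kappa> (Suc (line \<kappa> c)) e"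
  proof (rule landing_cell_eqI)
    show "kind (L ! i) = \<kappa>" by (simp add: \<kappa>_def)
    show "(if kind (L ! i) then \<epsilon> else \<delta>) = version (L ! i)" by (simp add: version_def)
    show "0 < e" by fact
  next
    fix j z
    assume M: "M i m (mk_cell \<kappa> (Suc (line \<kappa> c)) j) = Some z" and j: "j < e"
    have "young (shape (F n) m \<union> \<nu>)" using growthD(2)[OF growth_F] y by (intro young_Un)
    moreover have "mk_cell \<kappa> (Suc (line \<kappa> c)) j \<in> shape (F n) m \<union> \<nu>" using M dom by auto
    ultimately have "0 < j" using young_pos[of "shape (F n) m \<union> \<nu>" \<kappa> "Suc (line \<kappa> c)" j] by simp
    hence "mk_cell \<kappa> (Suc (line \<kappa> c)) j \<in> dom (N i (Suc m))"
      using e(3)[of j] j dom_N[of i "Suc m"] assms(1) by (simp add: \<nu>_def)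
    hence "N i (Suc m) (mk_cell \<kappa> (Suc (line \<kappa> c)) j) = Some z"
      using M by (auto simp: M_def)
    then obtain i' where i': "i' < i" "L ! i' \<le> Suc m" "w (L ! i') = z"
        "p i' (Suc m) = mk_cell \<kappa> (Suc (line \<kappa> c)) j"
      using N_Some by blast
    show "\<not> can_bump (version (L ! i)) A (w (L ! i)) z"
    proof (rule order_cases[OF i'(1) assms(1)])
      assume *: "w (L ! i') = w (L ! i)" "version (L ! i') = Regular"
      hence "version (L ! i) = Regular" by (simp add: version_def)
      thus ?thesis using * irrefl i'(3) by simp
    next
      \<comment> \<open>Here the dual rule would bump an equal letter, but copies under that rule
        never share a line.\<close>
      assume *: "w (L ! i') = w (L ! i)" "version (L ! i') = Dual"
      hence "line (kind (L ! i')) (p i' (Suc m)) < line (kind (L ! i')) (p i (Suc m))"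
        using below_copies[OF i'(1) assms(1)] i'(2) by (simp add: below_def)
      moreover have "kind (L ! i') = \<kappa>" using * by (simp add: \<kappa>_def)
      ultimately show ?thesis using i'(4) pi(2) by simp
    next
      assume "w (L ! i') \<noteq> w (L ! i)" "(w (L ! i), w (L ! i')) \<notin> A"
      thus ?thesis using i'(3) by (cases "version (L ! i)") auto
    qed
  next
    fix z
    let ?e = "mk_cell \<kappa> (Suc (line \<kappa> c)) e"
    assume M: "M i m ?e = Some z"
    have e\<nu>: "?e \<notin> \<nu>" using e(3)[of e] by simp
    hence "?e \<notin> dom (N i (Suc m))" using dom_N[of i "Suc m"] assms(1) by (simp add: \<nu>_def)
    hence "N n m ?e = Some z" using M by (simp add: M_def map_add_dom_app_simps)
    then obtain i' where i': "i' < n" "L ! i' \<le> m" "w (L ! i') = z" "p i' m = ?e"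
      using N_Some by blast
    have "\<not> i' < i"
    proof
      assume "i' < i"
      hence "?e \<in> shape (F i) m" using p_in_shape[of i' i m] i' assms(1) by simp
      thus False using e\<nu> by (simp add: \<nu>_def shape_Suc)
    qed
    moreover have "i' \<noteq> i"
    proof
      assume "i' = i"
      hence "line \<kappa> c = line \<kappa> ?e" using pi(1) i'(4) by simp
      thus False by simp
    qed
    ultimately have ii': "i < i'" by simp
    show "can_bump (version (L ! i)) A (w (L ! i)) z"
    proof (rule order_cases[OF ii' i'(1)])
      \<comment> \<open>A regular insertion would pass over the equal letter on e, but a larger copy
        is in no later line than the one item i comes from.\<close>
      assume *: "w (L ! i) = w (L ! i')" "version (L ! i) = Regular" "L ! i < L ! i'"
      hence "line \<kappa> (p i' m) \<le> line \<kappa> (p i m)"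
        using below_copies[OF ii' i'(1)] i'(2) by (simp add: below_def \<kappa>_def)
      thus ?thesis using i'(4) pi(1) by simp
    next
      assume "w (L ! i) = w (L ! i')" "version (L ! i) = Dual"
      thus ?thesis using i'(3) by simp
    next
      assume "(w (L ! i), w (L ! i')) \<in> A"
      thus ?thesis using i'(3) by (cases "version (L ! i)") auto
    qed
  next
    let ?row = "\<lambda>j. mk_cell \<kappa> (Suc (line \<kappa> c)) j"
    assume "M i m (?row e) = None"
    hence "?row e \<notin> dom (M i m)" by (simp add: domIff)
    hence no: "?row e \<notin> shape (F n) m \<union> \<nu>" unfolding dom by simp
    have yn: "young (shape (F n) m \<union> \<nu>)" using growthD(2)[OF growth_F] y by (intro young_Un)
    show "{j. ?row j \<in> dom (M i m)} = {1..<e}"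
    proof (intro set_eqI iffI)
      fix j assume "j \<in> {j. ?row j \<in> dom (M i m)}"
      hence j: "?row j \<in> shape (F n) m \<union> \<nu>" using dom by simp
      have "0 < j" using young_pos[OF yn j] by simp
      moreover have "\<not> e \<le> j"
        using young_closed[OF yn j, of "Suc (line \<kappa> c)" e] no e(1) by blast
      ultimately show "j \<in> {1..<e}" by simp
    next
      fix j assume "j \<in> {1..<e}"
      thus "j \<in> {j. ?row j \<in> dom (M i m)}" using e(3)[of j] dom by simp
    qed
  qed
  thus ?thesis using F by (simp add: next_line_eq c_def \<kappa>_def)
qed

text \<open>What remains of the insertion once the \<open>i\<close> smallest items have moved. It does not depend on
  \<open>i\<close>, and for \<open>i = n\<close> it is the result.\<close>

definition bump_on :: "nat \<Rightarrow> nat \<Rightarrow> letter filling \<times> cell" where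
  "bump_on i m = (case N n m (F i (Suc m)) of None \<Rightarrow> (M i m, F i (Suc m))
     | Some z \<Rightarrow> insert_from A \<epsilon> \<delta> (M i m) z (next_line (F i (Suc m)) z))"

text \<open>The smaller items, already moved, leave the landing cell free, so the displaced entry is
  the one that the old filling has there.\<close>

lemma insert_from_hit:
  assumes "i < n" "hits i m"
  shows "insert_from A \<epsilon> \<delta> (M i m) (w (L ! i)) (next_line (F i (Suc m)) (w (L ! i))) = bump_on (Suc i) m"
proof -
  let ?e = "F (Suc i) (Suc m)"
  have "?e \<notin> shape (F i) (Suc m)"
    using F_hit[OF assms] p_notin[of i "Suc m"] assms(1) by simp
  hence "?e \<notin> dom (N i (Suc m))" using dom_N[of i "Suc m"] assms(1) by simp
  hence "M i m ?e = N n m ?e" by (simp add: M_def map_add_dom_app_simps)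
  thus ?thesis
    using insert_from_step[OF landing_cell_M[OF assms]]
    unfolding bump_on_def M_hit[OF assms] by simp
qed

text \<open>Either item i is the entry just displaced and now makes its move, or it is not affected,
  and both the filling and the current cell stay as they are.\<close>

lemma bump_on_step:
  assumes "i < n" "F i (Suc m) \<noteq> (0, 0)"
  shows "bump_on i m = bump_on (Suc i) m"
proof (cases "hits i m")
  case True
  have c: "p i m = F i (Suc m)" using hits_p[OF assms(1) True] .
  hence "L ! i \<le> m" using assms p_eq_zero[of i m] by simp
  hence "N n m (F i (Suc m)) = Some (w (L ! i))" using N_p[of i n m] assms(1) c by simp
  thus ?thesis using insert_from_hit[OF assms(1) True] by (simp add: bump_on_def)
next
  case False
  show ?thesis unfolding bump_on_def M_no_hit[OF assms(1) False] F_no_hit[OF assms(1) False] ..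
qed

lemma F_nonzero_mono: "i \<le> j \<Longrightarrow> F i m \<noteq> (0, 0) \<Longrightarrow> F j m \<noteq> (0, 0)"
  unfolding F_eq_zero using set_take_subset_set_take[of i j L] by blast

lemma bump_on_final: "i \<le> n \<Longrightarrow> F i (Suc m) \<noteq> (0, 0) \<Longrightarrow> bump_on i m = bump_on n m"
proof (induction i rule: inc_induct)
  case (step i)
  thus ?case using bump_on_step F_nonzero_mono[of i "Suc i"] by simp
qed simp

lemma M_final: "M n m = N n (Suc m)"
proof -
  have "dom (N n m) \<subseteq> dom (N n (Suc m))" using dom_N[of n] by (auto simp: shape_Suc)
  thus ?thesis by (auto simp: M_def map_add_def fun_eq_iff split: option.splits)
qed

lemma bump_on_n:
  assumes "F n (Suc m) \<noteq> (0, 0)"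
  shows "bump_on n m = (N n (Suc m), F n (Suc m))"
proof -
  have "F n (Suc m) \<notin> shape (F n) m" using growthD(4)[OF growth_F, of n m] assms by simp
  hence "F n (Suc m) \<notin> dom (N n m)" by (simp add: dom_N)
  thus ?thesis by (simp add: bump_on_def M_final domIff)
qed

lemma insert_from_time:
  assumes "m < n"
  shows "insert_from A \<epsilon> \<delta> (N n m) (w (Suc m)) 1 = (N n (Suc m), F n (Suc m))"
proof -
  have "Suc m \<in> set L" using assms by (simp add: set_L)
  then obtain i where i: "i < n" "L ! i = Suc m" by (metis in_set_conv_nth length_L)
  \<comment> \<open>The items smaller than the new one do nothing at this time, so the chain starts
    at item i, coming from the virtual cell.\<close>
  have F0: "F j (Suc m) = (0, 0)" if "j \<le> i" for j using F_item[OF that i(1)] i(2) by simp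
  have M: "M j m = N n m" if "j \<le> i" for j
    using that
  proof (induction j)
    case (Suc j)
    have "L ! j \<noteq> L ! i"
      using Suc.prems i(1) nth_eq_iff_index_eq[OF distinct, of j i] by (simp add: length_L)
    hence "\<not> hits j m" using F0[of j] Suc.prems i(2) by (simp add: hits_iff)
    thus ?case using M_no_hit[of j m] Suc i(1) by simp
  qed (simp add: M_def)
  have hits: "hits i m" by (simp add: hits_iff i(2))
  have "F (Suc i) (Suc m) \<noteq> (0, 0)" by (simp add: F_hit(1)[OF i(1) hits])
  hence "bump_on (Suc i) m = bump_on n m" "F n (Suc m) \<noteq> (0, 0)"
    using bump_on_final[of "Suc i" m] F_nonzero_mono[of "Suc i" n "Suc m"] i(1) by simp_all
  thus ?thesis
    using insert_from_hit[OF i(1) hits] F0[of i] M[of i] bump_on_n i(2) by (simp add: next_line_eq)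
qed

end

text \<open>Meant for paths that grow at every time from 1 to m; a time without growth would be
  recorded on the virtual cell.\<close>

primrec recording :: "path \<Rightarrow> nat \<Rightarrow> nat filling" where
  "recording f 0 = Map.empty"
| "recording f (Suc m) = (recording f m)(f (Suc m) \<mapsto> Suc m)"

lemma (in item_order) rsk_eq:
  assumes "length v = n" "\<And>m. m < n \<Longrightarrow> w (Suc m) = v ! m"
  shows "rsk \<epsilon> \<delta> A v = (N n n, recording (F n) n)"
proof -
  let ?step = "\<lambda>(m, x) (P, Q). let (P', c) = insert_from A \<epsilon> \<delta> P x 1 in (P', Q(c \<mapsto> m))"
  have N_0: "N i 0 = Map.empty" if "i \<le> n" for i
    using that
  proof (induction i)
    case (Suc i)
    thus ?case using nth_L(1)[of i] by simp
  qed simp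
  have "fold ?step (enumerate 1 (take m v)) (Map.empty, Map.empty) = (N n m, recording (F n) m)"
    if "m \<le> n" for m
    using that
  proof (induction m)
    case (Suc m)
    have "enumerate 1 (take (Suc m) v) = enumerate 1 (take m v) @ [(Suc m, w (Suc m))]"
      using Suc.prems assms by (simp add: take_Suc_conv_app_nth enumerate_append_eq)
    thus ?case using Suc insert_from_time[of m] by simp
  qed (simp add: N_0)
  from this[of n] show ?thesis using assms(1) by (simp add: rsk_def)
qed

section \<open>Standardisation\<close>

lemma insort_key_cong:
  "(\<And>y. y \<in> set xs \<Longrightarrow> f x \<le> f y \<longleftrightarrow> g x \<le> g y) \<Longrightarrow> insort_key f x xs = insort_key g x xs"
  by (induction xs) auto

text \<open>Two shuffles give different numerical keys; within one kind they only compare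
  alike.\<close>

lemma sort_key_cong:
  "(\<And>x y. x \<in> set xs \<Longrightarrow> y \<in> set xs \<Longrightarrow> f x \<le> f y \<longleftrightarrow> g x \<le> g y) \<Longrightarrow>
    sort_key f xs = sort_key g xs"
proof (induction xs)
  case (Cons x xs)
  have "sort_key f xs = sort_key g xs" using Cons by simp
  thus ?case using Cons.prems by (auto intro!: insort_key_cong)
qed simp

section \<open>The standardised items of a word under one shuffle\<close>

locale shuffle_word =
  fixes k l n :: nat and A :: "letter rel" and \<epsilon> \<delta> :: variant and v :: "letter list"
  assumes A: "A \<in> shuffle_orders k l" and v: "v \<in> words k l n"
begin

definition w :: "nat \<Rightarrow> letter" where
  "w s = v ! (s - 1)"

definition rank :: "letter \<Rightarrow> nat" where
  "rank x = card {y \<in> letters k l. (y, x) \<in> A}"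

definition tie :: "nat \<Rightarrow> nat" where
  "tie s = (if (if is_t (w s) then \<epsilon> else \<delta>) = Regular then s else n - s)"

text \<open>The lexicographic order by letter and then by tie, packed into one number for
  \<open>sort_key\<close>; it works because ties are at most n for the times of the word.\<close>

definition key :: "nat \<Rightarrow> nat" where
  "key s = rank (w s) * Suc n + tie s"

definition items :: "nat list" where
  "items = sort_key key [1..<Suc n]"

lemma order_A: "trans A" "irrefl A" "total_on (letters k l) A"
  using A by (simp_all add: shuffle_orders_def strict_linear_order_on_def)

lemma asym_A: "(x, y) \<in> A \<Longrightarrow> (y, x) \<notin> A"
  using order_A by (meson irreflD transD)

lemma w_letters: "s \<in> {1..n} \<Longrightarrow> w s \<in> letters k l"
  using v by (auto simp: w_def words_def)

lemma rank_less:
  assumes "(x, y) \<in> A" "x \<in> letters k l"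
  shows "rank x < rank y"
  unfolding rank_def
proof (rule psubset_card_mono)
  show "finite {z \<in> letters k l. (z, y) \<in> A}" by (simp add: letters_def)
  show "{z \<in> letters k l. (z, x) \<in> A} \<subset> {z \<in> letters k l. (z, y) \<in> A}"
    using assms asym_A order_A(1) by (blast dest: transD)
qed

lemma key_less_of_letter_less:
  assumes "s \<in> {1..n}" "t \<in> {1..n}" "(w s, w t) \<in> A"
  shows "key s < key t"
proof -
  have "Suc (rank (w s)) \<le> rank (w t)" using rank_less[OF assms(3)] w_letters[OF assms(1)] by simp
  hence "Suc (rank (w s)) * Suc n \<le> rank (w t) * Suc n" by (rule mult_le_mono1)
  moreover have "tie s < Suc n" using assms(1) by (auto simp: tie_def)
  ultimately show ?thesis unfolding key_def by simp
qed

lemma key_less_iff: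
  assumes "s \<in> {1..n}" "t \<in> {1..n}"
  shows "key s < key t \<longleftrightarrow> (w s, w t) \<in> A \<or> w s = w t \<and>
    (if (if is_t (w s) then \<epsilon> else \<delta>) = Regular then s < t else t < s)"
proof (cases "w s = w t")
  case True
  thus ?thesis using assms order_A(2) by (auto simp: key_def tie_def irreflD)
next
  case False
  hence "(w s, w t) \<in> A \<or> (w t, w s) \<in> A"
    using order_A(3) w_letters assms by (auto simp: total_on_def)
  thus ?thesis
    using False key_less_of_letter_less[OF assms] key_less_of_letter_less[OF assms(2,1)] asym_A
    by (auto dest: less_asym)
qed

lemma inj_key: "inj_on key {1..n}"
proof (rule inj_onI)
  fix s t assume st: "s \<in> {1..n}" "t \<in> {1..n}" "key s = key t"
  hence "\<not> key s < key t" "\<not> key t < key s" by simp_all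
  hence "w s = w t"
    using order_A(3) w_letters[OF st(1)] w_letters[OF st(2)]
    unfolding key_less_iff[OF st(1,2)] key_less_iff[OF st(2,1)] total_on_def by blast
  thus "s = t"
    using \<open>\<not> key s < key t\<close> \<open>\<not> key t < key s\<close>
    unfolding key_less_iff[OF st(1,2)] key_less_iff[OF st(2,1)] by (auto split: if_splits)
qed

lemma items: "distinct items" "set items = {1..n}"
  by (auto simp: items_def)

sublocale item_order A \<epsilon> \<delta> w items n
proof
  fix i j assume ij: "i < j" "j < n"
  have len: "length items = n" by (simp add: items_def)
  have in_items: "items ! i \<in> {1..n}" "items ! j \<in> {1..n}"
    using ij len nth_mem[of i items] nth_mem[of j items] items(2) by auto
  have "items ! i \<noteq> items ! j" using ij len items(1) by (simp add: nth_eq_iff_index_eq)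
  hence "key (items ! i) \<noteq> key (items ! j)"
    using inj_key in_items by (simp add: inj_on_eq_iff)
  moreover have "sorted (map key items)" by (simp add: items_def)
  hence "key (items ! i) \<le> key (items ! j)"
    using sorted_nth_mono[of "map key items" i j] ij len by simp
  ultimately have "key (items ! i) < key (items ! j)" by simp
  thus "(w (items ! i), w (items ! j)) \<in> A \<or> w (items ! i) = w (items ! j) \<and>
      (if (if is_t (w (items ! i)) then \<epsilon> else \<delta>) = Regular then items ! i < items ! j
       else items ! j < items ! i)"
    using key_less_iff[OF in_items] by simp
qed (fact items, fact items, rule asym_A)

definition final_path :: path where
  "final_path = add_items (\<lambda>s. is_t (w s)) items (\<lambda>_. (0, 0))"

lemma rsk_final_path:
  "rsk \<epsilon> \<delta> A v = (P, Q) \<Longrightarrow>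
    sh P = shape final_path n - {(0, 0)} \<and> Q = recording final_path n"
proof -
  have "F n = final_path" using length_L by (simp add: F_def final_path_def)
  moreover have "rsk \<epsilon> \<delta> A v = (N n n, recording (F n) n)"
    using v by (intro rsk_eq) (simp_all add: words_def w_def)
  ultimately show "rsk \<epsilon> \<delta> A v = (P, Q) \<Longrightarrow> ?thesis"
    using dom_N[of n n] by (auto simp: sh_def)
qed

end

text \<open>Within one kind every shuffle orders the letters by index, and asymmetry excludes any
  other pair.\<close>

lemma shuffle_order_same_kind:
  assumes "A \<in> shuffle_orders k l" "B \<in> shuffle_orders k l" "(x, y) \<in> A" "is_t x = is_t y"
  shows "(x, y) \<in> B"
proof -
  have A: "A \<subseteq> letters k l \<times> letters k l" "trans A" "irrefl A"
    using assms(1) by (simp_all add: shuffle_orders_def strict_linear_order_on_def)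
  hence asym: "(y, x) \<notin> A" "x \<noteq> y" using assms(3) by (meson irreflD transD)+
  have "x \<in> letters k l" "y \<in> letters k l" using A(1) assms(3) by auto
  hence "(\<exists>i j. x = T i \<and> y = T j \<and> {i, j} \<subseteq> {1..k}) \<or> (\<exists>i j. x = U i \<and> y = U j \<and> {i, j} \<subseteq> {1..l})"
    using assms(4) by (auto simp: letters_def)
  thus ?thesis
  proof (elim disjE exE conjE)
    fix i j assume xy: "x = T i" "y = T j" "{i, j} \<subseteq> {1..k}"
    have "\<not> j < i" "i \<noteq> j" using asym xy assms(1) by (auto simp: shuffle_orders_def)
    thus ?thesis using xy assms(2) by (auto simp: shuffle_orders_def)
  next
    fix i j assume xy: "x = U i" "y = U j" "{i, j} \<subseteq> {1..l}"
    have "\<not> j < i" "i \<noteq> j" using asym xy assms(1) by (auto simp: shuffle_orders_def)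
    thus ?thesis using xy assms(2) by (auto simp: shuffle_orders_def)
  qed
qed

lemma final_path_independent:
  assumes "A \<in> shuffle_orders k l" "B \<in> shuffle_orders k l" "v \<in> words k l n"
  shows "shuffle_word.final_path k l n A \<epsilon> \<delta> v = shuffle_word.final_path k l n B \<epsilon> \<delta> v"
proof -
  interpret A: shuffle_word k l n A \<epsilon> \<delta> v by unfold_locales (use assms in auto)
  interpret B: shuffle_word k l n B \<epsilon> \<delta> v by unfold_locales (use assms in auto)
  let ?t = "\<lambda>s. is_t (A.w s)"
  have le: "A.key s \<le> A.key t \<longleftrightarrow> B.key s \<le> B.key t"
    if "s \<in> {1..n}" "t \<in> {1..n}" "?t s = ?t t" for s t
    using A.key_less_iff[OF that(2,1)] B.key_less_iff[OF that(2,1)] that(3)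
      shuffle_order_same_kind[OF assms(1,2), of "A.w t" "A.w s"]
      shuffle_order_same_kind[OF assms(2,1), of "A.w t" "A.w s"]
    unfolding not_less[symmetric] by metis
  \<comment> \<open>Filtering commutes with sorting, so both sides sort the same times of one kind,
    by keys that compare alike.\<close>
  have "filter (\<lambda>s. ?t s = b) A.items = filter (\<lambda>s. ?t s = b) B.items" for b
    unfolding A.items_def B.items_def filter_sort
    by (rule sort_key_cong, rule le) (simp_all del: upt_Suc)
  from this[of True] this[of False]
  have "filter ?t A.items = filter ?t B.items"
    "filter (\<lambda>s. \<not> ?t s) A.items = filter (\<lambda>s. \<not> ?t s) B.items" by simp_all
  thus ?thesis
    unfolding A.final_path_def B.final_path_def
      add_items_partition[OF A.fresh_L] add_items_partition[OF B.fresh_L] by simp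
qed

theorem theorem5:
  fixes k l n :: nat and v :: "letter list" and A B :: "letter rel"
    and \<epsilon> \<delta> :: variant
    and P\<^sub>A P\<^sub>B :: "letter filling" and Q\<^sub>A Q\<^sub>B :: "nat filling"
  assumes "k + l > 0" and "n \<ge> 1"
    and "v \<in> words k l n"
    and "A \<in> shuffle_orders k l" and "B \<in> shuffle_orders k l"
    and "rsk \<epsilon> \<delta> A v = (P\<^sub>A, Q\<^sub>A)"
    and "rsk \<epsilon> \<delta> B v = (P\<^sub>B, Q\<^sub>B)"
  shows "sh P\<^sub>A = sh P\<^sub>B \<and> Q\<^sub>A = Q\<^sub>B"
proof -
  have "shuffle_word k l n A v" "shuffle_word k l n B v" by unfold_locales (use assms in auto)
  thus ?thesis
    using shuffle_word.rsk_final_path assms(6,7) final_path_independent[OF assms(4,5,3)] by metis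
qed

end
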